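(* Up to isomorphism there are exactly four $4$-regular graphs with girth $5$ and diameter $4$ that have order $4^2+4+2=22$. Their automorphism groups have orders $1$, $2$, $4$ and $8$ respectively.
   Context: Graphs are finite, simple and undirected. The order of a graph is its number of vertices; its diameter is the maximum distance between a pair of its vertices (so a graph of finite diameter is connected); its girth is the length of its smallest circuit. *)

theory Defs
  imports "Graph_Theory.Graph_Theory" "HOL-Algebra.Bij" "HOL-Algebra.Coset" "HOL-Library.Extended_Nat"
begin

text \<open>
  Finite simple undirected graphs are the \<^locale>\<open>pair_graph\<close>s: an edge between \<open>u\<close> and \<open>v\<close>
  is the pair of arcs \<open>(u, v)\<close>, \<open>(v, u)\<close>, and the degree of a vertex is its out-degree.
\<close>

definition regular_graph :: "nat \<Rightarrow> 'a pair_pre_digraph \<Rightarrow> bool" where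
  "regular_graph k G \<longleftrightarrow> pair_graph G \<and> (\<forall>v \<in> pverts G. out_degree (with_proj G) v = k)"

text \<open>
  The library distance \<open>\<mu>\<close> with unit costs is \<open>\<infinity>\<close> between vertices in different components.
\<close>

definition diameter :: "'a pair_pre_digraph \<Rightarrow> ereal" where
  "diameter G = (SUP (u, v) \<in> pverts G \<times> pverts G. wf_digraph.\<mu> (with_proj G) (\<lambda>_. 1) u v)"

text \<open>
  Each edge traversed back and forth is a \<open>cycle\<close> of length 2 in the sense of the library, but
  not a circuit of the undirected graph. The girth of a forest is \<open>\<infinity>\<close>.
\<close>

definition girth :: "'a pair_pre_digraph \<Rightarrow> enat" where
  "girth G = (INF p \<in> {p. pre_digraph.cycle (with_proj G) p \<and> 3 \<le> length p}. enat (length p))"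

definition aut_group :: "'a pair_pre_digraph \<Rightarrow> ('a \<Rightarrow> 'a) monoid" where
  "aut_group G = (BijGroup (pverts G))
    \<lparr>carrier := {f \<in> Bij (pverts G). \<forall>u \<in> pverts G. \<forall>v \<in> pverts G.
        (f u, f v) \<in> parcs G \<longleftrightarrow> (u, v) \<in> parcs G}\<rparr>"

text \<open>
  On graphs without parallel arcs the library isomorphism is a bijection of the vertices that
  preserves and reflects adjacency.
\<close>

lemma digraph_iso_pair_iff:
  assumes G: "pair_wf_digraph G" and H: "pair_wf_digraph H"
  shows "digraph_iso (with_proj G) (with_proj H) \<longleftrightarrow>
    (\<exists>f. bij_betw f (pverts G) (pverts H) \<and>
      (\<forall>u \<in> pverts G. \<forall>v \<in> pverts G. (f u, f v) \<in> parcs H \<longleftrightarrow> (u, v) \<in> parcs G))"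
    (is "_ \<longleftrightarrow> (\<exists>f. ?P f)")
proof
  assume "digraph_iso (with_proj G) (with_proj H)"
  then obtain h where h: "pre_digraph.digraph_isomorphism (with_proj G) h"
      "with_proj H = app_iso h (with_proj G)"
    unfolding digraph_iso_def by blast
  let ?f = "iso_verts h"
  have inj: "inj_on ?f (pverts G)"
    using h(1) by (simp add: pre_digraph.digraph_isomorphism_def)
  from h(2) have VH: "pverts H = ?f ` pverts G" and AH: "parcs H = iso_arcs h ` parcs G"
    and t: "iso_tail h = fst" and hd: "iso_head h = snd"
    by (simp_all add: app_iso_def with_proj_def)
  have arc: "iso_arcs h a = (?f (fst a), ?f (snd a))" if "a \<in> parcs G" for a
    using h(1) that by (simp add: pre_digraph.digraph_isomorphism_def t hd prod_eq_iff)
  have "?P ?f"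
  proof (intro conjI ballI)
    show "bij_betw ?f (pverts G) (pverts H)" using inj VH by (simp add: bij_betw_def)
    fix u v assume uv: "u \<in> pverts G" "v \<in> pverts G"
    show "(?f u, ?f v) \<in> parcs H \<longleftrightarrow> (u, v) \<in> parcs G"
    proof
      assume "(?f u, ?f v) \<in> parcs H"
      then obtain a where a: "a \<in> parcs G" "iso_arcs h a = (?f u, ?f v)"
        unfolding AH by auto
      then have "?f (fst a) = ?f u" "?f (snd a) = ?f v" using arc by auto
      moreover have "fst a \<in> pverts G" "snd a \<in> pverts G"
        using a(1) G pair_wf_digraph.arc_fst_in_verts pair_wf_digraph.arc_snd_in_verts by blast+
      ultimately have "fst a = u" "snd a = v" using inj uv by (auto dest: inj_onD)
      then show "(u, v) \<in> parcs G" using a(1) by auto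
    next
      assume "(u, v) \<in> parcs G"
      then show "(?f u, ?f v) \<in> parcs H" using arc unfolding AH by force
    qed
  qed
  then show "\<exists>f. ?P f" by (intro exI)
next
  assume "\<exists>f. ?P f"
  then obtain f where f: "?P f" by (elim exE)
  let ?h = "\<lparr>iso_verts = f, iso_arcs = map_prod f f, iso_head = snd, iso_tail = fst\<rparr>"
  have inj: "inj_on f (pverts G)" and VH: "f ` pverts G = pverts H"
    using f by (auto simp: bij_betw_def)
  have sub: "parcs G \<subseteq> pverts G \<times> pverts G" "parcs H \<subseteq> pverts H \<times> pverts H"
    using G H by (auto simp: pair_wf_digraph_def)
  have "inj_on (map_prod f f) (parcs G)"
    using map_prod_inj_on[OF inj inj] sub(1) by (rule inj_on_subset)
  then have "pre_digraph.digraph_isomorphism (with_proj G) ?h"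
    using inj G by (simp add: pre_digraph.digraph_isomorphism_def wf_digraph_wp_iff)
  moreover have "map_prod f f ` parcs G = parcs H"
  proof
    show "map_prod f f ` parcs G \<subseteq> parcs H" using f sub(1) by auto
    show "parcs H \<subseteq> map_prod f f ` parcs G"
    proof
      fix a assume a: "a \<in> parcs H"
      then obtain u v where "u \<in> pverts G" "v \<in> pverts G" "a = (f u, f v)"
        using sub(2) VH by (cases a) blast
      with a f show "a \<in> map_prod f f ` parcs G" by force
    qed
  qed
  then have "with_proj H = app_iso ?h (with_proj G)"
    using VH by (simp add: app_iso_def with_proj_def)
  ultimately show "digraph_iso (with_proj G) (with_proj H)"
    unfolding digraph_iso_def by blast
qed

lemma group_aut_group: "group (aut_group G)"
proof -
  let ?A = "{f \<in> Bij (pverts G). \<forall>u \<in> pverts G. \<forall>v \<in> pverts G.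
        (f u, f v) \<in> parcs G \<longleftrightarrow> (u, v) \<in> parcs G}"
  have img: "f x \<in> pverts G" if "f \<in> Bij (pverts G)" "x \<in> pverts G" for f x
    using that by (auto simp: Bij_def bij_betw_def)
  have "subgroup ?A (BijGroup (pverts G))"
  proof (rule group.subgroupI[OF group_BijGroup])
    show "?A \<subseteq> carrier (BijGroup (pverts G))" by (auto simp: BijGroup_def)
    show "?A \<noteq> {}" using id_Bij[of "pverts G"] by auto
  next
    fix f assume f: "f \<in> ?A"
    let ?g = "\<lambda>x \<in> pverts G. inv_into (pverts G) f x"
    have B: "f \<in> Bij (pverts G)" using f by simp
    have gB: "?g \<in> Bij (pverts G)" using restrict_inv_into_Bij[OF B] .
    have fg: "f (?g x) = x" if "x \<in> pverts G" for x
      using B that by (simp add: Bij_def bij_betw_def f_inv_into_f)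
    have "(?g u, ?g v) \<in> parcs G \<longleftrightarrow> (u, v) \<in> parcs G"
      if "u \<in> pverts G" "v \<in> pverts G" for u v
    proof -
      have "(f (?g u), f (?g v)) \<in> parcs G \<longleftrightarrow> (?g u, ?g v) \<in> parcs G"
        using f img[OF gB that(1)] img[OF gB that(2)] by blast
      then show ?thesis by (simp only: fg[OF that(1)] fg[OF that(2)])
    qed
    then have "?g \<in> ?A" using gB by blast
    then show "inv\<^bsub>BijGroup (pverts G)\<^esub> f \<in> ?A" by (simp only: inv_BijGroup[OF B])
  next
    fix f g assume fg: "f \<in> ?A" "g \<in> ?A"
    then have "compose (pverts G) f g \<in> Bij (pverts G)" by (simp add: compose_Bij)
    moreover have "(compose (pverts G) f g u, compose (pverts G) f g v) \<in> parcs G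
        \<longleftrightarrow> (u, v) \<in> parcs G" if "u \<in> pverts G" "v \<in> pverts G" for u v
      using fg that img[of g] by (simp add: compose_eq)
    ultimately show "f \<otimes>\<^bsub>BijGroup (pverts G)\<^esub> g \<in> ?A"
      using fg by (simp add: BijGroup_def)
  qed
  then show ?thesis
    unfolding aut_group_def by (rule group.subgroup_imp_group[OF group_BijGroup])
qed

end

theory Submission
  imports Defs "HOL-Library.Countable"
begin

text \<open>
  Let \<open>x\<close> and \<open>y\<close> be at distance 4 in a 4-regular graph of girth 5 on 22 vertices. The ball of
  radius 2 about \<open>x\<close> has \<open>1 + 4 + 12 = 17\<close> vertices and is disjoint from the closed neighbourhood
  of \<open>y\<close>, which has 5; so the two exhaust the graph. The same holds with \<open>x\<close> and \<open>y\<close> exchanged.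
  Hence the 12 vertices outside the closed neighbourhoods of \<open>x\<close> and \<open>y\<close> are at distance 2 from
  both, and each has one neighbour next to \<open>x\<close> (its row) and one next to \<open>y\<close> (its column). As there
  are no 4-cycles, a row and a column meet in at most one vertex, and each row misses exactly one
  column. Numbering the columns accordingly, the 12 vertices become the off-diagonal cells of a
  4 by 4 grid (\<open>obtain_frame\<close>).

  What remains of the graph is a 2-regular graph on the cells. Girth 5 says that each cell and its
  two neighbours lie in three different rows and three different columns, and that there are neither
  triangles nor squares among the cells. This is a small constraint satisfaction problem. Up to
  simultaneous permutations of rows and columns and transposition of the grid, its solutions are four
  cycles of length 12; an exhaustive search, evaluated by rewriting, establishes this
  (\<open>search_complete\<close>). So every graph in question is one of four (\<open>classification\<close>).

  Conversely the four graphs have diameter 4: in a graph of this kind any two balls of radius 2 meet,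
  because \<open>17 + 17 > 22\<close>, so no distance exceeds 4 (\<open>diameter_eq_4I\<close>). A second search lists their
  automorphisms (\<open>order_aut_group_model\<close>). The four groups have different orders, and so no two of
  the graphs are isomorphic.
\<close>

section \<open>Girth, distance and balls of radius two\<close>

definition nbhd :: "'a pair_pre_digraph \<Rightarrow> 'a \<Rightarrow> 'a set" where
  "nbhd G v = {w. (v, w) \<in> parcs G}"

text \<open>
  Girth at least 5 in terms of adjacency. On a loopless graph the two clauses exclude triangles and
  cycles of length 4.
\<close>

definition no_short_cycle :: "'a pair_pre_digraph \<Rightarrow> bool" where
  "no_short_cycle G \<longleftrightarrow>
    (\<forall>u v w. (u, v) \<in> parcs G \<and> (v, w) \<in> parcs G \<longrightarrow> (w, u) \<notin> parcs G) \<and>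
    (\<forall>u v a b. (a, u) \<in> parcs G \<and> (a, v) \<in> parcs G \<and> (b, u) \<in> parcs G \<and> (b, v) \<in> parcs G
       \<longrightarrow> a = b \<or> u = v)"

text \<open>
  Distance at least 4, written out so that it can be checked and transported along injections without
  reference to walks.
\<close>

definition far :: "'a pair_pre_digraph \<Rightarrow> 'a \<Rightarrow> 'a \<Rightarrow> bool" where
  "far G u v \<longleftrightarrow> u \<in> pverts G \<and> v \<in> pverts G \<and> u \<noteq> v \<and> (u, v) \<notin> parcs G \<and>
    (\<forall>a. (u, a) \<in> parcs G \<longrightarrow> (a, v) \<notin> parcs G) \<and>
    (\<forall>a b. (u, a) \<in> parcs G \<and> (a, b) \<in> parcs G \<longrightarrow> (b, v) \<notin> parcs G)"

lemma no_short_cycleD: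
  assumes "no_short_cycle G"
  shows no_triangle: "(u, v) \<in> parcs G \<Longrightarrow> (v, w) \<in> parcs G \<Longrightarrow> (w, u) \<notin> parcs G"
    and no_square: "(a, u) \<in> parcs G \<Longrightarrow> (a, v) \<in> parcs G \<Longrightarrow> (b, u) \<in> parcs G \<Longrightarrow> (b, v) \<in> parcs G
       \<Longrightarrow> a = b \<or> u = v"
  using conjunct1[OF assms[unfolded no_short_cycle_def]]
    conjunct2[OF assms[unfolded no_short_cycle_def]] by - (iprover, iprover)

context pair_graph
begin

lemma sym_arc: "(u, v) \<in> parcs G \<Longrightarrow> (v, u) \<in> parcs G"
  by (rule arcs_symmetric)

lemma irrefl_arc: "(u, u) \<notin> parcs G"
  using pair_no_loops[of "(u, u)"] by auto

lemma cycle_iff: "cycle p \<longleftrightarrow> (\<exists>u. awalk u p u \<and> distinct (tl (pawalk_verts u p)) \<and> p \<noteq> [])"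
  by (simp only: cycle_def)

lemma girth_ge_5:
  assumes "no_short_cycle G"
  shows "girth G \<ge> 5"
  unfolding girth_def
proof (rule INF_greatest)
  fix p assume "p \<in> {p. cycle p \<and> 3 \<le> length p}"
  then obtain u where p: "awalk u p u" "distinct (tl (pawalk_verts u p))" "3 \<le> length p"
    unfolding cycle_iff by auto
  have "\<not> length p \<le> 4"
  proof
    assume "length p \<le> 4"
    then consider e1 e2 e3 where "p = [e1, e2, e3]" | e1 e2 e3 e4 where "p = [e1, e2, e3, e4]"
      using p(3) by (auto simp: le_Suc_eq numeral_eq_Suc length_Suc_conv)
    then show False
    proof cases
      case 1
      then obtain a b where "p = [(u, a), (a, b), (b, u)]"
        using p(1) by (cases e1; cases e2; cases e3) (auto simp: awalk_simps)
      then have "(u, a) \<in> parcs G" "(a, b) \<in> parcs G" "(b, u) \<in> parcs G"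
        using p(1) by (auto simp: awalk_simps)
      then show False using no_triangle[OF assms] by blast
    next
      case 2
      then obtain a b c where abc: "p = [(u, a), (a, b), (b, c), (c, u)]"
        using p(1) by (cases e1; cases e2; cases e3; cases e4) (auto simp: awalk_simps)
      then have "(u, a) \<in> parcs G" "(a, b) \<in> parcs G" "(b, c) \<in> parcs G" "(c, u) \<in> parcs G"
        using p(1) by (auto simp: awalk_simps)
      moreover have "u \<noteq> b" "a \<noteq> c" using p(2) abc by auto
      ultimately show False
        using no_square[OF assms, of u a c b] sym_arc[of a b] sym_arc[of c u] by blast
    qed
  qed
  then have "5 \<le> length p" by simp
  then have "enat 5 \<le> enat (length p)" by (simp only: enat_ord_simps)
  then show "5 \<le> enat (length p)" by (simp add: numeral_eq_enat)
qed

lemma girth_le_cycle: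
  assumes "awalk u p u" "distinct (tl (pawalk_verts u p))" "3 \<le> length p"
  shows "girth G \<le> enat (length p)"
  unfolding girth_def using assms by (intro INF_lower) (auto simp: cycle_iff)

lemma girth_5_imp_no_short_cycle:
  assumes "girth G = 5"
  shows "no_short_cycle G"
proof -
  have 3: False if "(u, v) \<in> parcs G" "(v, w) \<in> parcs G" "(w, u) \<in> parcs G" for u v w
  proof -
    have "girth G \<le> enat (length [(u, v), (v, w), (w, u)])"
      using that irrefl_arc in_arcsD1[OF that(1)] by (intro girth_le_cycle[of u]) (auto simp: awalk_simps)
    then show False using assms by (simp add: numeral_eq_enat)
  qed
  have 4: "a = b \<or> u = v" if "(a, u) \<in> parcs G" "(a, v) \<in> parcs G" "(b, u) \<in> parcs G" "(b, v) \<in> parcs G"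
    for u v a b
  proof (rule ccontr)
    assume "\<not> (a = b \<or> u = v)"
    then have "girth G \<le> enat (length [(a, u), (u, b), (b, v), (v, a)])"
      using that irrefl_arc in_arcsD1[OF that(1)] sym_arc[OF that(2)] sym_arc[OF that(3)]
      by (intro girth_le_cycle[of a]) (auto simp: awalk_simps)
    then show False using assms by (simp add: numeral_eq_enat)
  qed
  show ?thesis unfolding no_short_cycle_def using 3 4 by blast
qed

lemma girth_eq_5I:
  assumes "no_short_cycle G"
    and "(a, b) \<in> parcs G" "(b, c) \<in> parcs G" "(c, d) \<in> parcs G" "(d, e) \<in> parcs G" "(e, a) \<in> parcs G"
    and "distinct [a, b, c, d, e]"
  shows "girth G = 5"
proof (rule antisym)
  have "girth G \<le> enat (length [(a, b), (b, c), (c, d), (d, e), (e, a)])"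
    using assms in_arcsD1[OF assms(2)] by (intro girth_le_cycle[of a]) (auto simp: awalk_simps)
  then show "girth G \<le> 5" by (simp add: numeral_eq_enat numeral_eq_Suc)
  show "5 \<le> girth G" by (rule girth_ge_5[OF assms(1)])
qed

lemma unit_cost: "awalk_cost (\<lambda>_. 1) p = real (length p)"
  by (induction p) auto

lemma mu_le_iff:
  "\<mu> (\<lambda>_. 1) u v \<le> ereal (real n) \<longleftrightarrow> (\<exists>p. awalk u p v \<and> length p \<le> n)"
proof
  assume "\<exists>p. awalk u p v \<and> length p \<le> n"
  then obtain p where p: "awalk u p v" "length p \<le> n" by blast
  have "\<mu> (\<lambda>_. 1) u v \<le> awalk_cost (\<lambda>_. 1) p" using p(1) by (rule min_cost_le_walk_cost)
  also have "\<dots> \<le> ereal (real n)" using p(2) by (simp add: unit_cost)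
  finally show "\<mu> (\<lambda>_. 1) u v \<le> ereal (real n)" .
next
  assume a: "\<mu> (\<lambda>_. 1) u v \<le> ereal (real n)"
  show "\<exists>p. awalk u p v \<and> length p \<le> n"
  proof (rule ccontr)
    assume "\<not> (\<exists>p. awalk u p v \<and> length p \<le> n)"
    then have "real (Suc n) \<le> real (length p)" if "awalk u p v" for p
      using that by (metis not_less_eq_eq of_nat_le_iff)
    then have "ereal (real (Suc n)) \<le> \<mu> (\<lambda>_. 1) u v"
      unfolding \<mu>_def by (intro INF_greatest) (simp only: mem_Collect_eq unit_cost ereal_less_eq)
    with a have "ereal (real (Suc n)) \<le> ereal (real n)" by (rule order_trans[rotated])
    then show False by simp
  qed
qed

lemma far_iff_mu:
  assumes "u \<in> pverts G" "v \<in> pverts G"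
  shows "far G u v \<longleftrightarrow> \<not> \<mu> (\<lambda>_. 1) u v \<le> 3"
proof -
  have "\<mu> (\<lambda>_. 1) u v \<le> 3 \<longleftrightarrow> (\<exists>p. awalk u p v \<and> length p \<le> 3)"
    using mu_le_iff[of u v 3] by simp
  also have "\<dots> \<longleftrightarrow> \<not> far G u v"
  proof
    assume "\<exists>p. awalk u p v \<and> length p \<le> 3"
    then obtain p where p: "awalk u p v" "length p \<le> 3" by blast
    from p(2) consider "p = []" | e1 where "p = [e1]" | e1 e2 where "p = [e1, e2]"
      | e1 e2 e3 where "p = [e1, e2, e3]"
      by (auto simp: le_Suc_eq numeral_eq_Suc length_Suc_conv)
    then show "\<not> far G u v"
      using p(1) by cases (auto simp: awalk_simps far_def)
  next
    assume "\<not> far G u v"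
    then consider "u = v" | "(u, v) \<in> parcs G" | a where "(u, a) \<in> parcs G" "(a, v) \<in> parcs G"
      | a b where "(u, a) \<in> parcs G" "(a, b) \<in> parcs G" "(b, v) \<in> parcs G"
      using assms by (auto simp: far_def)
    then show "\<exists>p. awalk u p v \<and> length p \<le> 3"
    proof cases
      case 1 then show ?thesis using assms by (intro exI[of _ "[]"]) (auto simp: awalk_simps)
    next
      case 2 then show ?thesis using assms by (intro exI[of _ "[(u,v)]"]) (auto simp: awalk_simps)
    next
      case 3 then show ?thesis using assms by (intro exI[of _ "[(u,a),(a,v)]"]) (auto simp: awalk_simps)
    next
      case 4 then show ?thesis using assms
        by (intro exI[of _ "[(u,a),(a,b),(b,v)]"]) (auto simp: awalk_simps)
    qed
  qed
  finally show ?thesis by blast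
qed

lemma diameter_4_obtains_far:
  assumes "diameter G = 4"
  obtains x y where "far G x y"
proof -
  have "\<not> diameter G \<le> 3" using assms by simp
  then obtain u v where "u \<in> pverts G" "v \<in> pverts G" "\<not> \<mu> (\<lambda>_. 1) u v \<le> 3"
    unfolding diameter_def by (auto simp: SUP_le_iff)
  then show thesis using far_iff_mu that by blast
qed

definition ball2 :: "'a \<Rightarrow> 'a set" where
  "ball2 v = insert v (nbhd G v \<union> (\<Union>a \<in> nbhd G v. nbhd G a - {v}))"

lemma nbhd_sub: "nbhd G v \<subseteq> pverts G"
  using in_arcsD2 by (auto simp: nbhd_def)

lemma finite_nbhd: "finite (nbhd G v)"
  using nbhd_sub pair_finite_verts finite_subset by blast

lemma card_nbhd: "card (nbhd G v) = out_degree (with_proj G) v"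
proof -
  have "out_arcs (with_proj G) v = Pair v ` nbhd G v"
    by (auto simp: out_arcs_def nbhd_def)
  then show ?thesis by (simp add: out_degree_def card_image inj_on_def)
qed

lemma ball2_sub: "v \<in> pverts G \<Longrightarrow> ball2 v \<subseteq> pverts G"
  using nbhd_sub unfolding ball2_def by blast

lemma card_ball2:
  assumes reg: "\<And>v. v \<in> pverts G \<Longrightarrow> card (nbhd G v) = 4"
    and nsc: "no_short_cycle G" and v: "v \<in> pverts G"
  shows "card (ball2 v) = 17"
proof -
  let ?S = "\<lambda>a. nbhd G a - {v}"
  have "card (\<Union>a \<in> nbhd G v. ?S a) = (\<Sum>a \<in> nbhd G v. card (?S a))"
  proof (rule card_UN_disjoint)
    show "\<forall>a \<in> nbhd G v. \<forall>b \<in> nbhd G v. a \<noteq> b \<longrightarrow> ?S a \<inter> ?S b = {}"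
    proof (intro ballI impI)
      fix a b assume "a \<in> nbhd G v" "b \<in> nbhd G v" "a \<noteq> b"
      then have "(a, v) \<in> parcs G" "(b, v) \<in> parcs G" by (simp_all add: nbhd_def sym_arc)
      then have "z = v" if "(a, z) \<in> parcs G" "(b, z) \<in> parcs G" for z
        using no_square[OF nsc, of a z v b] that \<open>a \<noteq> b\<close> by blast
      then show "?S a \<inter> ?S b = {}" by (auto simp: nbhd_def)
    qed
  qed (auto simp: finite_nbhd)
  also have "\<dots> = (\<Sum>a \<in> nbhd G v. 3)"
  proof (rule sum.cong)
    fix a assume a: "a \<in> nbhd G v"
    then have "a \<in> pverts G" using nbhd_sub by blast
    moreover have "v \<in> nbhd G a" using a sym_arc[of v a] by (simp add: nbhd_def)
    ultimately show "card (?S a) = 3" using reg[of a] by simp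
  qed simp
  also have "\<dots> = 12" using reg[OF v] by simp
  finally have c: "card (\<Union>a \<in> nbhd G v. ?S a) = 12" .
  have disj: "nbhd G v \<inter> (\<Union>a \<in> nbhd G v. ?S a) = {}"
    
  proof -
    have "(a, z) \<notin> parcs G" if "(v, a) \<in> parcs G" "(v, z) \<in> parcs G" for a z
      using no_triangle[OF nsc that(1)] sym_arc[OF that(2)] by blast
    then show ?thesis by (auto simp: nbhd_def)
  qed
  have "card (nbhd G v \<union> (\<Union>a \<in> nbhd G v. ?S a)) = 4 + 12"
    using reg[OF v] c finite_nbhd by (subst card_Un_disjoint[OF _ _ disj]) auto
  moreover have "v \<notin> nbhd G v \<union> (\<Union>a \<in> nbhd G v. ?S a)"
    using irrefl_arc by (auto simp: nbhd_def)
  ultimately show "card (ball2 v) = 17"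
    unfolding ball2_def using finite_nbhd by (simp add: card_insert_if)
qed

text \<open>
  The upper bound needs no connectivity: two balls of radius 2 with 17 vertices each cannot be disjoint
  in a graph with fewer than 34 vertices, and walks of length at most 2 into a common vertex compose to
  a walk of length at most 4.
\<close>

lemma diameter_eq_4I:
  assumes reg: "\<And>v. v \<in> pverts G \<Longrightarrow> card (nbhd G v) = 4"
    and nsc: "no_short_cycle G" and few: "card (pverts G) < 34" and far: "far G x y"
  shows "diameter G = 4"
proof (rule antisym)
  have "\<mu> (\<lambda>_. 1) u v \<le> 4" if uv: "u \<in> pverts G" "v \<in> pverts G" for u v
  proof -
    have to: "\<exists>p q. awalk s p z \<and> length p \<le> 2 \<and> awalk z q s \<and> length q \<le> 2"
      if s: "s \<in> pverts G" and z: "z \<in> ball2 s" for s z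
    proof -
      consider "z = s" | "(s, z) \<in> parcs G" | a where "(s, a) \<in> parcs G" "(a, z) \<in> parcs G"
        using z by (auto simp: ball2_def nbhd_def)
      then show ?thesis
      proof cases
        case 1 then show ?thesis using s by (intro exI[of _ "[]"]) (simp add: awalk_simps)
      next
        case 2 then show ?thesis using s sym_arc[OF 2] in_arcsD2[OF 2]
          by (intro exI[of _ "[(s,z)]"] exI[of _ "[(z,s)]"]) (simp add: awalk_simps)
      next
        case 3 then show ?thesis using s sym_arc[OF 3(1)] sym_arc[OF 3(2)] in_arcsD2[OF 3(2)]
          by (intro exI[of _ "[(s,a),(a,z)]"] exI[of _ "[(z,a),(a,s)]"]) (simp add: awalk_simps)
      qed
    qed
    have "ball2 u \<inter> ball2 v \<noteq> {}"
    proof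
      assume "ball2 u \<inter> ball2 v = {}"
      then have "card (ball2 u \<union> ball2 v) = 34"
        using card_ball2[OF reg nsc uv(1)] card_ball2[OF reg nsc uv(2)]
          finite_subset[OF ball2_sub[OF uv(1)] pair_finite_verts]
          finite_subset[OF ball2_sub[OF uv(2)] pair_finite_verts]
        by (simp add: card_Un_disjoint)
      moreover have "card (ball2 u \<union> ball2 v) \<le> card (pverts G)"
        using ball2_sub[OF uv(1)] ball2_sub[OF uv(2)] pair_finite_verts by (intro card_mono) auto
      ultimately show False using few by simp
    qed
    then obtain z where "z \<in> ball2 u" "z \<in> ball2 v" by blast
    with to[OF uv(1)] to[OF uv(2)] obtain p q
      where "awalk u p z" "length p \<le> 2" "awalk z q v" "length q \<le> 2" by metis
    then have "\<exists>p. awalk u p v \<and> length p \<le> 4"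
      by (intro exI[of _ "p @ q"]) (auto intro: awalk_appendI)
    then show ?thesis using mu_le_iff[of u v 4] by simp
  qed
  then show "diameter G \<le> 4" unfolding diameter_def by (auto simp: SUP_le_iff)
  have xy: "x \<in> pverts G" "y \<in> pverts G" using far by (auto simp: far_def)
  have "\<not> \<mu> (\<lambda>_. 1) x y \<le> ereal (real 3)" using far far_iff_mu[OF xy] by simp
  then have "real 4 \<le> real (length p)" if "awalk x p y" for p
    using that unfolding mu_le_iff by (auto simp: not_le)
  then have "ereal (real 4) \<le> \<mu> (\<lambda>_. 1) x y"
    unfolding \<mu>_def by (intro INF_greatest) (simp only: mem_Collect_eq unit_cost ereal_less_eq)
  also have "\<dots> \<le> diameter G" unfolding diameter_def using xy by (intro SUP_upper2[of "(x, y)"]) auto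
  finally show "4 \<le> diameter G" by simp
qed

end

lemma regular_graph_iff:
  "regular_graph k G \<longleftrightarrow> pair_graph G \<and> (\<forall>v \<in> pverts G. card (nbhd G v) = k)"
  by (auto simp: regular_graph_def pair_graph.card_nbhd)

text \<open>
  A homomorphism between regular graphs of the same degree that is bijective on vertices maps each
  neighbourhood into, hence by counting onto, the neighbourhood of the image. Therefore only the
  preservation of adjacency has to be checked, both for isomorphisms and for automorphisms.
\<close>

lemma regular_hom_iff:
  assumes G: "regular_graph k G" and H: "regular_graph k H"
    and f: "bij_betw f (pverts G) (pverts H)"
    and hom: "\<And>u v. (u, v) \<in> parcs G \<Longrightarrow> (f u, f v) \<in> parcs H"
    and uv: "u \<in> pverts G" "v \<in> pverts G"
  shows "(f u, f v) \<in> parcs H \<longleftrightarrow> (u, v) \<in> parcs G"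
proof
  interpret G: pair_graph G using G by (simp add: regular_graph_iff)
  interpret H: pair_graph H using H by (simp add: regular_graph_iff)
  have inj: "inj_on f (pverts G)" using f by (simp add: bij_betw_def)
  have fu: "f u \<in> pverts H" using f uv(1) by (auto simp: bij_betw_def)
  have "f ` nbhd G u = nbhd H (f u)"
  proof (rule card_subset_eq)
    show "finite (nbhd H (f u))" by (rule H.finite_nbhd)
    show "f ` nbhd G u \<subseteq> nbhd H (f u)" using hom by (auto simp: nbhd_def)
    have "card (f ` nbhd G u) = card (nbhd G u)"
      by (rule card_image) (rule inj_on_subset[OF inj G.nbhd_sub])
    then show "card (f ` nbhd G u) = card (nbhd H (f u))"
      using G H uv(1) fu by (simp add: regular_graph_iff)
  qed
  moreover assume "(f u, f v) \<in> parcs H"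
  ultimately obtain w where "(u, w) \<in> parcs G" "f v = f w" by (auto simp: nbhd_def set_eq_iff image_iff)
  then show "(u, v) \<in> parcs G" using inj_onD[OF inj, of v w] uv(2) G.in_arcsD2 by auto
qed (rule hom)

section \<open>The grid behind two vertices at distance four\<close>

datatype ix = I0 | I1 | I2 | I3

text \<open>
  \<open>X\<close> and \<open>Y\<close> are the two vertices at distance 4, \<open>R\<close> and \<open>C\<close> their neighbours, which label the rows
  and the columns of a 4 by 4 grid, and \<open>M i j\<close> with \<open>i \<noteq> j\<close> is the remaining vertex in row \<open>i\<close> and
  column \<open>j\<close>. The diagonal values \<open>M i i\<close> are junk and excluded from \<open>model_verts\<close>.
\<close>

datatype vert = X | Y | R ix | C ix | M ix ix

definition ixs :: "ix list" where "ixs = [I0, I1, I2, I3]"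

definition cells :: "vert list" where
  "cells = map (\<lambda>(i, j). M i j) (filter (\<lambda>(i, j). i \<noteq> j) (List.product ixs ixs))"

definition model_verts :: "vert list" where
  "model_verts = X # Y # map R ixs @ map C ixs @ cells"

lemma set_ixs: "set ixs = UNIV"
proof -
  have "i \<in> set ixs" for i by (cases i) (auto simp: ixs_def)
  then show ?thesis by blast
qed

lemma mem_cells: "c \<in> set cells \<longleftrightarrow> (\<exists>i j. i \<noteq> j \<and> c = M i j)"
  by (auto simp: cells_def set_ixs)

lemma mem_model_verts [simp]: "X \<in> set model_verts" "Y \<in> set model_verts" "R i \<in> set model_verts" "C i \<in> set model_verts"
    "M i j \<in> set model_verts \<longleftrightarrow> i \<noteq> j"
  by (auto simp: model_verts_def mem_cells set_ixs)

lemma cells_sub_model_verts: "c \<in> set cells \<Longrightarrow> c \<in> set model_verts"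
  by (auto simp: mem_cells)

lemma card_model_verts: "card (set model_verts) = 22"
  by code_simp

text \<open>
  All edges of the graph except those between two cells. They are the same for every graph in question.
\<close>

fun frame :: "vert \<Rightarrow> vert \<Rightarrow> bool" where
  "frame X (R i) = True"
| "frame (R i) X = True"
| "frame Y (C j) = True"
| "frame (C j) Y = True"
| "frame (R i) (M k l) = (i = k)"
| "frame (M k l) (R i) = (i = k)"
| "frame (C j) (M k l) = (j = l)"
| "frame (M k l) (C j) = (j = l)"
| "frame _ _ = False"

definition framed :: "'a pair_pre_digraph \<Rightarrow> (vert \<Rightarrow> 'a) \<Rightarrow> bool" where
  "framed G f \<longleftrightarrow> bij_betw f (set model_verts) (pverts G) \<and>
    (\<forall>u \<in> set model_verts. \<forall>v \<in> set model_verts. frame u v \<longrightarrow> (f u, f v) \<in> parcs G)"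

lemma (in pair_graph) far_sym: "far G u v \<Longrightarrow> far G v u"
  unfolding far_def using arcs_symmetric by metis

text \<open>
  The key structural fact. Two counting arguments carry it: the ball of radius 2 about one end and the
  closed neighbourhood of the other end partition the 22 vertices, and the three further neighbours of
  a row vertex are attached to three different columns, so that exactly one of the four columns is
  missed. That missed column receives the same index as the row.
\<close>

lemma (in pair_graph) obtain_frame:
  assumes reg: "\<And>v. v \<in> pverts G \<Longrightarrow> card (nbhd G v) = 4"
    and nsc: "no_short_cycle G" and V: "card (pverts G) = 22" and far: "far G x y"
  obtains f where "framed G f"
proof -
  have xy: "x \<in> pverts G" "y \<in> pverts G" "x \<noteq> y" using far by (auto simp: far_def)
  define A where "A = nbhd G x"
  define B where "B = nbhd G y"
  have fin: "finite A" "finite B" and cA: "card A = 4" and cB: "card B = 4"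
    using reg xy finite_nbhd by (auto simp: A_def B_def)
  have AV: "a \<in> A \<Longrightarrow> a \<in> pverts G" and BV: "a \<in> B \<Longrightarrow> a \<in> pverts G" for a
    using nbhd_sub by (auto simp: A_def B_def)
  have xA: "(x, a) \<in> parcs G" "(a, x) \<in> parcs G" if "a \<in> A" for a
    using that sym_arc[of x a] by (auto simp: A_def nbhd_def)
  have yB: "(y, b) \<in> parcs G" "(b, y) \<in> parcs G" if "b \<in> B" for b
    using that sym_arc[of y b] by (auto simp: B_def nbhd_def)
  have sq: "a = b \<or> u = v" if "(a, u) \<in> parcs G" "(a, v) \<in> parcs G" "(b, u) \<in> parcs G" "(b, v) \<in> parcs G"
    for a b u v using no_square[OF nsc that] .
  define S where "S s = (\<Union>a \<in> nbhd G s. nbhd G a - {s})" for s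
  \<comment> \<open>The ball about \<open>s\<close> has 17 vertices and the closed neighbourhood of \<open>z\<close> has 5, which leaves no others.\<close>
  have split: "pverts G = S s \<union> (insert s (nbhd G s) \<union> insert z (nbhd G z))"
    "S s \<inter> (insert s (nbhd G s) \<union> insert z (nbhd G z)) = {}"
    "insert s (nbhd G s) \<inter> insert z (nbhd G z) = {}"
    if sz: "far G s z" for s z
  proof -
    have s: "s \<in> pverts G" "z \<in> pverts G" using sz by (auto simp: far_def)
    have ball: "ball2 s = S s \<union> insert s (nbhd G s)" by (auto simp: ball2_def S_def)
    have disj: "ball2 s \<inter> insert z (nbhd G z) = {}"
    proof -
      have "p \<notin> insert z (nbhd G z)" if p: "p \<in> ball2 s" for p
      proof
        assume "p \<in> insert z (nbhd G z)"
        then have p2: "p = z \<or> (p, z) \<in> parcs G" using sym_arc[of z p] by (auto simp: nbhd_def)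
        from p consider "p = s" | "(s, p) \<in> parcs G" | a where "(s, a) \<in> parcs G" "(a, p) \<in> parcs G"
          by (auto simp: ball2_def nbhd_def)
        then show False using p2 sz unfolding far_def by cases blast+
      qed
      then show ?thesis by blast
    qed
    have "z \<notin> nbhd G z" using irrefl_arc by (simp add: nbhd_def)
    then have "card (insert z (nbhd G z)) = 5" using reg[OF s(2)] finite_nbhd by simp
    then have "card (ball2 s \<union> insert z (nbhd G z)) = 22"
      using card_ball2[OF reg nsc s(1)] finite_subset[OF ball2_sub[OF s(1)] pair_finite_verts] finite_nbhd
      by (subst card_Un_disjoint[OF _ _ disj]) auto
    moreover have "ball2 s \<union> insert z (nbhd G z) \<subseteq> pverts G"
      using ball2_sub[OF s(1)] nbhd_sub[of z] s by blast
    ultimately have "ball2 s \<union> insert z (nbhd G z) = pverts G"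
      using V pair_finite_verts by (intro card_subset_eq) auto
    then show "pverts G = S s \<union> (insert s (nbhd G s) \<union> insert z (nbhd G z))"
      using ball by blast
    show "insert s (nbhd G s) \<inter> insert z (nbhd G z) = {}" using disj ball by blast
    have "S s \<inter> insert s (nbhd G s) = {}"
    proof -
      have "p \<notin> insert s (nbhd G s)" if p: "p \<in> S s" for p
      proof -
        obtain a where a: "(s, a) \<in> parcs G" "(a, p) \<in> parcs G" "p \<noteq> s"
          using p by (auto simp: S_def nbhd_def)
        have "(p, s) \<notin> parcs G" using no_triangle[OF nsc a(1,2)] .
        then show ?thesis using a(3) sym_arc[of s p] by (auto simp: nbhd_def)
      qed
      then show ?thesis by blast
    qed
    then show "S s \<inter> (insert s (nbhd G s) \<union> insert z (nbhd G z)) = {}"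
      using disj ball by blast
  qed
  note sp = split[OF far] split[OF far_sym[OF far]]
  have SS: "S x = S y"
    using sp(1,2) sp(4,5) by blast
  have middle: "p \<noteq> x" "p \<noteq> y" "p \<notin> A" "p \<notin> B" "p \<in> pverts G" if "p \<in> S x" for p
    using that sp(1,2) by (auto simp: A_def B_def)
  have disjAB: "A \<inter> B = {}" "x \<notin> A" "x \<notin> B" "y \<notin> A" "y \<notin> B"
    using sp(3) irrefl_arc by (auto simp: A_def B_def nbhd_def)
  have exA: "\<exists>a \<in> A. (a, p) \<in> parcs G" if "p \<in> S x" for p
    using that by (auto simp: S_def A_def nbhd_def)
  have exB: "\<exists>b \<in> B. (b, p) \<in> parcs G" if "p \<in> S x" for p
    using that unfolding SS by (auto simp: S_def B_def nbhd_def)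
  have three: "card {p \<in> S x. (a, p) \<in> parcs G} = 3" if a: "a \<in> A \<or> a \<in> B" for a
  proof -
    obtain z where z: "z \<in> {x, y}" "(z, a) \<in> parcs G" "a \<in> pverts G"
      using a xA yB AV BV by blast
    have "{p \<in> S x. (a, p) \<in> parcs G} = nbhd G a - {z}"
    proof -
      have "{p \<in> S z. (a, p) \<in> parcs G} = nbhd G a - {z}"
      proof -
        have "z \<notin> S z" by (auto simp: S_def)
        then show ?thesis using z(2) by (auto simp: S_def nbhd_def)
      qed
      then show ?thesis using z(1) SS by auto
    qed
    moreover have "z \<in> nbhd G a" using sym_arc[OF z(2)] by (simp add: nbhd_def)
    ultimately show ?thesis using reg[OF z(3)] finite_nbhd by simp
  qed
  define J where "J a b p \<longleftrightarrow> p \<in> S x \<and> (a, p) \<in> parcs G \<and> (b, p) \<in> parcs G" for a b p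
  \<comment> \<open>Stated for both sides at once: for \<open>D = B\<close> it yields the column \<open>\<delta> a\<close> missed by the row \<open>a\<close>,
    and for \<open>D = A\<close> the injectivity of \<open>\<delta>\<close>.\<close>
  have miss: "\<exists>b. D - {b \<in> D. \<exists>p \<in> S x. (a, p) \<in> parcs G \<and> (b, p) \<in> parcs G} = {b}"
    if D: "D = B \<and> a \<in> A \<or> D = A \<and> a \<in> B" for D a
  proof -
    let ?P = "{p \<in> S x. (a, p) \<in> parcs G}"
    have "\<exists>b \<in> D. (b, p) \<in> parcs G" if "p \<in> ?P" for p using that D exA exB by auto
    then obtain \<beta> where b: "\<And>p. p \<in> ?P \<Longrightarrow> \<beta> p \<in> D \<and> (\<beta> p, p) \<in> parcs G" by metis
    have aD: "a \<notin> D" using D disjAB by blast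
    have inj: "inj_on \<beta> ?P"
    proof (rule inj_onI)
      fix p q assume pq: "p \<in> ?P" "q \<in> ?P" "\<beta> p = \<beta> q"
      then have "(\<beta> p, p) \<in> parcs G" "(\<beta> p, q) \<in> parcs G" "\<beta> p \<noteq> a"
        using b[OF pq(1)] b[OF pq(2)] pq(3) aD by auto
      then show "p = q" using sq[of a p q "\<beta> p"] pq by auto
    qed
    have eq: "{b \<in> D. \<exists>p \<in> S x. (a, p) \<in> parcs G \<and> (b, p) \<in> parcs G} = \<beta> ` ?P"
    proof
      show "\<beta> ` ?P \<subseteq> {b \<in> D. \<exists>p \<in> S x. (a, p) \<in> parcs G \<and> (b, p) \<in> parcs G}" using b by blast
      show "{b \<in> D. \<exists>p \<in> S x. (a, p) \<in> parcs G \<and> (b, p) \<in> parcs G} \<subseteq> \<beta> ` ?P"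
      proof
        fix d assume "d \<in> {b \<in> D. \<exists>p \<in> S x. (a, p) \<in> parcs G \<and> (b, p) \<in> parcs G}"
        then obtain p where d: "d \<in> D" "p \<in> ?P" "(d, p) \<in> parcs G" by blast
        obtain z where z: "\<And>e. e \<in> D \<Longrightarrow> (e, z) \<in> parcs G" "z \<in> {x, y}" using D xA yB by blast
        have "p \<noteq> z" using d(2) z(2) middle(1,2) by auto
        then have "\<beta> p = d" using sq[of "\<beta> p" p z d] b[OF d(2)] d z(1) by blast
        then show "d \<in> \<beta> ` ?P" using d(2) by blast
      qed
    qed
    have "card (D - \<beta> ` ?P) = 1"
    proof -
      have "\<beta> ` ?P \<subseteq> D" using b by blast
      moreover have "finite (\<beta> ` ?P)" using \<open>\<beta> ` ?P \<subseteq> D\<close> D fin finite_subset by blast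
      moreover have "card (\<beta> ` ?P) = 3" using card_image[OF inj] three D by auto
      moreover have "card D = 4" using D cA cB by auto
      ultimately show ?thesis by (simp add: card_Diff_subset)
    qed
    then show ?thesis unfolding eq by (rule card_1_singletonE) blast
  qed
  define linked where "linked a b \<longleftrightarrow> (\<exists>p \<in> S x. (a, p) \<in> parcs G \<and> (b, p) \<in> parcs G)" for a b
  have "\<exists>b. B - {b \<in> B. linked a b} = {b}" if "a \<in> A" for a
    using miss[of B a] that by (simp add: linked_def)
  then obtain \<delta> where \<delta>: "\<And>a. a \<in> A \<Longrightarrow> B - {b \<in> B. linked a b} = {\<delta> a}" by metis
  have \<delta>B: "\<delta> a \<in> B" and \<delta>link: "\<And>b. b \<in> B \<Longrightarrow> linked a b \<longleftrightarrow> b \<noteq> \<delta> a" if "a \<in> A" for a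
    using \<delta>[OF that] by blast+
  have inj\<delta>: "inj_on \<delta> A"
  proof (rule inj_onI)
    fix a a' assume a: "a \<in> A" "a' \<in> A" "\<delta> a = \<delta> a'"
    obtain c where "A - {c \<in> A. linked c (\<delta> a)} = {c}"
      using miss[of A "\<delta> a"] \<delta>B[OF a(1)] by (auto simp: linked_def conj_commute)
    moreover have "\<not> linked a (\<delta> a)" "\<not> linked a' (\<delta> a)"
      using \<delta>link[OF a(1) \<delta>B[OF a(1)]] \<delta>link[OF a(2) \<delta>B[OF a(1)]] a(3) by auto
    ultimately have "a \<in> {c}" "a' \<in> {c}" using a(1,2) by blast+
    then show "a = a'" by simp
  qed
  have "card (UNIV :: ix set) = card A" unfolding cA set_ixs[symmetric] by (simp add: ixs_def)
  then obtain \<rho> where \<rho>: "bij_betw \<rho> (UNIV :: ix set) A"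
    using finite_same_card_bij[of "UNIV :: ix set" A] fin finite_set[of ixs] by (auto simp: set_ixs)
  have \<rho>A: "\<rho> i \<in> A" for i using \<rho> by (auto simp: bij_betw_def)
  have \<rho>i: "\<rho> i = \<rho> j \<longleftrightarrow> i = j" for i j using \<rho> by (auto simp: bij_betw_def inj_eq)
  define \<gamma> where "\<gamma> j = \<delta> (\<rho> j)" for j
  have \<gamma>B: "\<gamma> j \<in> B" for j by (simp add: \<gamma>_def \<delta>B \<rho>A)
  have \<gamma>i: "\<gamma> i = \<gamma> j \<longleftrightarrow> i = j" for i j
    using inj_on_eq_iff[OF inj\<delta> \<rho>A \<rho>A] \<rho>i by (simp add: \<gamma>_def)
  have "\<exists>p. J (\<rho> i) (\<gamma> j) p" if "i \<noteq> j" for i j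
    using \<delta>link[OF \<rho>A \<gamma>B, of i j] that \<gamma>i[of j i] by (auto simp: J_def linked_def \<gamma>_def)
  then obtain \<tau> where \<tau>: "\<And>i j. i \<noteq> j \<Longrightarrow> J (\<rho> i) (\<gamma> j) (\<tau> i j)" by metis
  then have m: "\<tau> i j \<in> S x" "(\<rho> i, \<tau> i j) \<in> parcs G" "(\<gamma> j, \<tau> i j) \<in> parcs G" if "i \<noteq> j" for i j
    using that by (auto simp: J_def)
  have m_inj: "i = k \<and> j = l" if "i \<noteq> j" "k \<noteq> l" "\<tau> i j = \<tau> k l" for i j k l
  proof -
    note m1 = m[OF that(1)] and m2 = m[OF that(2), folded that(3)]
    have "\<rho> i = \<rho> k" using sq[OF xA(2)[OF \<rho>A] m1(2) xA(2)[OF \<rho>A] m2(2)] middle(1)[OF m1(1)] by blast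
    moreover have "\<gamma> j = \<gamma> l"
      using sq[OF yB(2)[OF \<gamma>B] m1(3) yB(2)[OF \<gamma>B] m2(3)] middle(2)[OF m1(1)] by blast
    ultimately show ?thesis using \<rho>i \<gamma>i by simp
  qed
  then have m_iff: "\<tau> i j = \<tau> k l \<longleftrightarrow> i = k \<and> j = l" if "i \<noteq> j" "k \<noteq> l" for i j k l
    using that by blast
  define f where "f v = (case v of X \<Rightarrow> x | Y \<Rightarrow> y | R i \<Rightarrow> \<rho> i | C j \<Rightarrow> \<gamma> j | M i j \<Rightarrow> \<tau> i j)" for v
  have fV: "f v \<in> pverts G" if "v \<in> set model_verts" for v
    by (cases v) (use that xy(1,2) AV[OF \<rho>A] BV[OF \<gamma>B] middle(5)[OF m(1)] in \<open>auto simp: f_def\<close>)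
  have inj: "inj_on f (set model_verts)"
  proof (rule inj_onI)
    fix u v assume uv: "u \<in> set model_verts" "v \<in> set model_verts" "f u = f v"
    have ne: "\<rho> i \<noteq> x" "\<rho> i \<noteq> y" "\<gamma> i \<noteq> x" "\<gamma> i \<noteq> y" "\<rho> i \<noteq> \<gamma> j" for i j
      using \<rho>A[of i] \<gamma>B[of i] \<gamma>B[of j] disjAB by auto
    have ne': "\<tau> i j \<noteq> x" "\<tau> i j \<noteq> y" "\<tau> i j \<noteq> \<rho> k" "\<tau> i j \<noteq> \<gamma> k" if "i \<noteq> j" for i j k
      using middle[OF m(1)[OF that]] \<rho>A \<gamma>B by metis+
    show "u = v"
      by (cases u; cases v)
        (use uv xy(3) ne ne' ne[symmetric] ne'[symmetric] \<rho>i \<gamma>i m_iff in \<open>auto simp: f_def\<close>)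
  qed
  have "f ` set model_verts = pverts G"
    using fV card_image[OF inj] card_model_verts V pair_finite_verts by (intro card_subset_eq) auto
  then have bij: "bij_betw f (set model_verts) (pverts G)" using inj by (simp add: bij_betw_def)
  have "(f u, f v) \<in> parcs G" if "frame u v" "u \<in> set model_verts" "v \<in> set model_verts" for u v
    by (cases "(u, v)" rule: frame.cases)
      (use that xA[OF \<rho>A] yB[OF \<gamma>B] m(2,3) sym_arc[OF m(2)] sym_arc[OF m(3)] in \<open>auto simp: f_def\<close>)
  then show thesis using bij by (intro that[of f]) (auto simp: framed_def)
qed

section \<open>The graph on the cells\<close>

text \<open>
  Cells that are adjacent, or adjacent to a common cell, share neither row nor column: otherwise they
  would lie on a triangle or a square through their row or column vertex.
\<close>

fun compatible :: "vert \<Rightarrow> vert \<Rightarrow> bool" where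
  "compatible (M i j) (M k l) \<longleftrightarrow> i \<noteq> k \<and> j \<noteq> l"
| "compatible _ _ \<longleftrightarrow> False"

fun pairs :: "'b list \<Rightarrow> ('b \<times> 'b) list" where
  "pairs [] = []"
| "pairs (x # xs) = map (Pair x) xs @ pairs xs"

definition choices :: "vert \<Rightarrow> (vert \<times> vert) list" where
  "choices c = filter (\<lambda>(a, b). compatible a b) (pairs (filter (compatible c) cells))"

text \<open>
  The constraints between two different cells \<open>c\<close> and \<open>d\<close> with neighbours \<open>a, b\<close> and \<open>e, g\<close>: adjacency
  is symmetric, adjacent cells have no common neighbour, and nonadjacent ones have at most one.
\<close>

fun agree :: "vert \<Rightarrow> vert \<times> vert \<Rightarrow> vert \<Rightarrow> vert \<times> vert \<Rightarrow> bool" where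
  "agree c (a, b) d (e, g) \<longleftrightarrow>
    (if a = d \<or> b = d then (c = e \<or> c = g) \<and> a \<noteq> e \<and> a \<noteq> g \<and> b \<noteq> e \<and> b \<noteq> g
     else c \<noteq> e \<and> c \<noteq> g \<and> (a = e \<longrightarrow> b \<noteq> g) \<and> (a = g \<longrightarrow> b \<noteq> e))"

fun agree_all :: "vert \<Rightarrow> vert \<times> vert \<Rightarrow> (vert \<times> vert \<times> vert) list \<Rightarrow> bool" where
  "agree_all c n [] \<longleftrightarrow> True"
| "agree_all c n ((d, k) # ps) \<longleftrightarrow> agree c n d k \<and> agree_all c n ps"

text \<open>
  Representatives of the solutions up to symmetries of the grid. In each of them the graph on the cells
  is a single cycle of length 12, listed here in cyclic order.
\<close>

definition ring :: "ix \<Rightarrow> vert list" where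
  "ring g = map (\<lambda>(i, j). M i j) (case g of
     I0 \<Rightarrow> [(I0,I1), (I1,I0), (I3,I2), (I2,I1), (I0,I3), (I1,I2), (I3,I1), (I2,I0), (I1,I3), (I0,I2), (I3,I0), (I2,I3)]
   | I1 \<Rightarrow> [(I0,I1), (I1,I0), (I3,I2), (I2,I1), (I1,I3), (I0,I2), (I2,I0), (I3,I1), (I0,I3), (I1,I2), (I3,I0), (I2,I3)]
   | I2 \<Rightarrow> [(I0,I1), (I2,I0), (I1,I3), (I0,I2), (I3,I1), (I2,I3), (I1,I0), (I3,I2), (I0,I3), (I2,I1), (I3,I0), (I1,I2)]
   | I3 \<Rightarrow> [(I0,I1), (I2,I0), (I1,I3), (I3,I2), (I2,I1), (I0,I3), (I1,I0), (I3,I1), (I0,I2), (I2,I3), (I3,I0), (I1,I2)])"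

text \<open>
  Predecessor and successor of \<open>v\<close> in a cyclic list. The first two arguments are the element before the
  current head and the element that follows the last one.
\<close>

fun around :: "'b \<Rightarrow> 'b \<Rightarrow> 'b list \<Rightarrow> 'b \<Rightarrow> 'b \<times> 'b" where
  "around p z [] v = (p, z)"
| "around p z [a] v = (p, z)"
| "around p z (a # b # xs) v = (if v = a then (p, b) else around a z (b # xs) v)"

definition ring_nbrs :: "ix \<Rightarrow> vert \<Rightarrow> vert \<times> vert" where
  "ring_nbrs g = around (last (ring g)) (hd (ring g)) (ring g)"

text \<open>
  Symmetries of the grid: \<open>Sym a b c d t\<close> renumbers rows and columns by \<open>I0 \<mapsto> a, I1 \<mapsto> b, I2 \<mapsto> c,
  I3 \<mapsto> d\<close> and then, if \<open>t\<close> holds, transposes the grid, which exchanges the roles of the vertices at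
  distance 4.
\<close>

datatype sym = Sym ix ix ix ix bool

fun perm :: "sym \<Rightarrow> ix \<Rightarrow> ix" where
  "perm (Sym a b c d t) I0 = a" | "perm (Sym a b c d t) I1 = b"
| "perm (Sym a b c d t) I2 = c" | "perm (Sym a b c d t) I3 = d"

fun act :: "sym \<Rightarrow> vert \<Rightarrow> vert" where
  "act (Sym a b c d t) X = (if t then Y else X)"
| "act (Sym a b c d t) Y = (if t then X else Y)"
| "act (Sym a b c d t) (R i) = (if t then C else R) (perm (Sym a b c d t) i)"
| "act (Sym a b c d t) (C j) = (if t then R else C) (perm (Sym a b c d t) j)"
| "act (Sym a b c d t) (M i j) = (if t then M (perm (Sym a b c d t) j) (perm (Sym a b c d t) i)
     else M (perm (Sym a b c d t) i) (perm (Sym a b c d t) j))"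

definition syms :: "sym list" where
  "syms = [Sym a b c d t. a \<leftarrow> ixs, b \<leftarrow> ixs, c \<leftarrow> ixs, d \<leftarrow> ixs, distinct [a,b,c,d], t \<leftarrow> [False, True]]"

fun same_pair :: "vert \<times> vert \<Rightarrow> vert \<times> vert \<Rightarrow> bool" where
  "same_pair (a, b) (e, g) \<longleftrightarrow> (a = e \<and> b = g) \<or> (a = g \<and> b = e)"

fun carries :: "ix \<Rightarrow> sym \<Rightarrow> (vert \<times> vert \<times> vert) list \<Rightarrow> bool" where
  "carries g s [] \<longleftrightarrow> True"
| "carries g s ((c, (a, b)) # ps) \<longleftrightarrow>
     same_pair (act s a, act s b) (ring_nbrs g (act s c)) \<and> carries g s ps"

fun some_carries :: "ix \<Rightarrow> sym list \<Rightarrow> (vert \<times> vert \<times> vert) list \<Rightarrow> bool" where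
  "some_carries g [] ps \<longleftrightarrow> False"
| "some_carries g (s # ss) ps \<longleftrightarrow> carries g s ps \<or> some_carries g ss ps"

definition is_ring :: "sym list \<Rightarrow> (vert \<times> vert \<times> vert) list \<Rightarrow> bool" where
  "is_ring ss ps \<longleftrightarrow> some_carries I0 ss ps \<or> some_carries I1 ss ps \<or> some_carries I2 ss ps \<or> some_carries I3 ss ps"

text \<open>
  Depth-first search over all assignments of a pair of neighbours to each cell; it succeeds if every
  complete assignment is carried to one of the rings by a listed symmetry. Explicit recursion over the
  choices, with the consistency test as first disjunct, lets rewriting decide the test before it
  unfolds the subtree behind it.
\<close>

function (sequential) search :: "sym list \<Rightarrow> (vert \<times> (vert \<times> vert) list) list \<Rightarrow> (vert \<times> vert \<times> vert) list \<Rightarrow> bool"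
  and search_from where
  "search ss [] ps \<longleftrightarrow> is_ring ss ps"
| "search ss ((c, ns) # rest) ps \<longleftrightarrow> search_from ss c ns rest ps"
| "search_from ss c [] rest ps \<longleftrightarrow> True"
| "search_from ss c (n # ns) rest ps \<longleftrightarrow>
     (\<not> agree_all c n ps \<or> search ss rest ((c, n) # ps)) \<and> search_from ss c ns rest ps"
  by pat_completeness auto
termination
  by (relation "measure (\<lambda>z. case z of
      Inl (ss, rest, _) \<Rightarrow> sum_list (map (\<lambda>(c, ns). length ns + 2) rest)
    | Inr (ss, c, ns, rest, _) \<Rightarrow> Suc (length ns) + sum_list (map (\<lambda>(c, ns). length ns + 2) rest))") auto

text \<open>
  The order in which cells are treated. Its early cells constrain each other strongly, which keeps the
  search tree to about six thousand nodes; row by row there would be about thirty thousand.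
\<close>

definition agenda :: "vert list" where
  "agenda = map (\<lambda>(i, j). M i j) [(I0,I2), (I1,I3), (I3,I1), (I2,I0), (I1,I0), (I3,I2), (I0,I3), (I2,I1),
     (I3,I0), (I0,I1), (I1,I2), (I2,I3)]"

lemma search_complete: "search syms (map (\<lambda>c. (c, choices c)) agenda) []"
  by code_simp

fun nbrs_via :: "(vert \<Rightarrow> vert \<times> vert) \<Rightarrow> vert \<Rightarrow> vert list" where
  "nbrs_via m X = map R ixs"
| "nbrs_via m Y = map C ixs"
| "nbrs_via m (R i) = X # map (M i) (remove1 i ixs)"
| "nbrs_via m (C j) = Y # map (\<lambda>i. M i j) (remove1 j ixs)"
| "nbrs_via m (M i j) = [R i, C j, fst (m (M i j)), snd (m (M i j))]"

lemma card_ix: "card (UNIV :: ix set) = 4"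
  unfolding set_ixs[symmetric] by (simp add: ixs_def)

lemma nbrs_viaD:
  "v \<in> set (nbrs_via m u) \<Longrightarrow> frame u v \<or> u \<notin> {X, Y} \<union> range R \<union> range C \<and> v \<in> {fst (m u), snd (m u)}"
  by (cases u) auto

lemma inj_perm:
  assumes "s \<in> set syms"
  shows "inj (perm s)"
proof -
  obtain a b c d t where s: "s = Sym a b c d t" "distinct [a, b, c, d]"
    using assms by (auto simp: syms_def split: if_splits)
  show ?thesis
  proof (rule injI)
    fix i j assume "perm s i = perm s j"
    then show "i = j" using s by (cases i; cases j) auto
  qed
qed

lemma act_inj: assumes "s \<in> set syms" shows "inj (act s)"
proof (rule injI)
  fix u v assume "act s u = act s v"
  then show "u = v" using injD[OF inj_perm[OF assms]]
    by (cases s; cases u; cases v) (auto split: if_splits)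
qed

lemma act_model_verts: assumes "s \<in> set syms" "u \<in> set model_verts" shows "act s u \<in> set model_verts"
  by (cases s; cases u) (use assms injD[OF inj_perm[OF assms(1)]] in \<open>auto split: if_splits\<close>)

lemma frame_act: assumes "s \<in> set syms" shows "frame (act s u) (act s v) = frame u v"
  by (cases s; cases u; cases v) (use injD[OF inj_perm[OF assms]] in auto)

lemma act_cell: "act s u \<in> set cells \<Longrightarrow> u \<in> set cells"
  by (cases s; cases u) (auto simp: mem_cells split: if_splits)

lemma act_image:
  assumes "s \<in> set syms"
  shows "act s ` set model_verts = set model_verts"
  using act_model_verts[OF assms] inj_on_subset[OF act_inj[OF assms] subset_UNIV]
  by (intro endo_inj_surj) auto

lemma some_carriesD: "some_carries g ss ps \<Longrightarrow> \<exists>s \<in> set ss. carries g s ps"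
  by (induction ss) auto

lemma carriesD: "carries g s ps \<Longrightarrow> (c, n) \<in> set ps \<Longrightarrow>
    same_pair (act s (fst n), act s (snd n)) (ring_nbrs g (act s c))"
  by (induction g s ps rule: carries.induct) auto

lemma is_ringD: "is_ring ss ps \<Longrightarrow> \<exists>g. \<exists>s \<in> set ss. carries g s ps"
  unfolding is_ring_def using some_carriesD by metis

lemma agree_all_iff: "agree_all c n ps \<longleftrightarrow> (\<forall>(d, k) \<in> set ps. agree c n d k)"
  by (induction c n ps rule: agree_all.induct) auto

lemma search_fromD:
  "search_from ss c ns rest ps \<Longrightarrow> n \<in> set ns \<Longrightarrow> agree_all c n ps \<Longrightarrow> search ss rest ((c, n) # ps)"
  by (induction ns) auto

text \<open>
  For a solution \<open>N\<close> of the constraint problem, the search follows the branch that chooses \<open>N c\<close> at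
  every cell and therefore reaches \<open>N\<close> as a leaf.
\<close>

lemma search_sound:
  assumes "search ss (map (\<lambda>c. (c, choices c)) cs) (map (\<lambda>c. (c, N c)) earlier)"
    and "\<And>c. c \<in> set cs \<Longrightarrow> N c \<in> set (choices c)"
    and "\<And>c d. c \<in> set cs \<union> set earlier \<Longrightarrow> d \<in> set cs \<union> set earlier \<Longrightarrow> c \<noteq> d \<Longrightarrow> agree c (N c) d (N d)"
    and "distinct (cs @ earlier)"
  shows "is_ring ss (map (\<lambda>c. (c, N c)) (rev cs @ earlier))"
  using assms
proof (induction cs arbitrary: earlier)
  case Nil
  then show ?case by simp
next
  case (Cons c cs)
  have "search_from ss c (choices c) (map (\<lambda>c. (c, choices c)) cs) (map (\<lambda>c. (c, N c)) earlier)"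
    using Cons.prems(1) by simp
  moreover have "agree_all c (N c) (map (\<lambda>c. (c, N c)) earlier)"
    unfolding agree_all_iff using Cons.prems(3)[of c] Cons.prems(4) by fastforce
  ultimately have "search ss (map (\<lambda>c. (c, choices c)) cs) (map (\<lambda>c. (c, N c)) (c # earlier))"
    using search_fromD Cons.prems(2)[of c] by simp
  then have "is_ring ss (map (\<lambda>c. (c, N c)) (rev cs @ (c # earlier)))"
    by (rule Cons.IH) (use Cons.prems(2-4) in auto)
  then show ?case by simp
qed

lemma set_agenda: "set agenda = set cells" by code_simp
lemma distinct_agenda: "distinct agenda" by code_simp

lemma pairs_complete:
  "a \<in> set xs \<Longrightarrow> b \<in> set xs \<Longrightarrow> a \<noteq> b \<Longrightarrow> (a, b) \<in> set (pairs xs) \<or> (b, a) \<in> set (pairs xs)"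
  by (induction xs) auto

definition cell_nbrs :: "'a pair_pre_digraph \<Rightarrow> (vert \<Rightarrow> 'a) \<Rightarrow> vert \<Rightarrow> vert set" where
  "cell_nbrs G f c = {d \<in> set cells. (f c, f d) \<in> parcs G}"

context pair_graph
begin

lemma framedD:
  assumes "framed G f"
  shows "u \<in> set model_verts \<Longrightarrow> v \<in> set model_verts \<Longrightarrow> frame u v \<Longrightarrow> (f u, f v) \<in> parcs G"
    and "u \<in> set model_verts \<Longrightarrow> v \<in> set model_verts \<Longrightarrow> f u = f v \<longleftrightarrow> u = v"
    and "u \<in> set model_verts \<Longrightarrow> f u \<in> pverts G"
  using assms by (auto simp: framed_def bij_betw_def inj_on_eq_iff)

lemma cell_nbrs_choice:
  assumes reg: "\<And>v. v \<in> pverts G \<Longrightarrow> card (nbhd G v) = 4"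
    and nsc: "no_short_cycle G" and f: "framed G f" and c: "c \<in> set cells"
  shows "\<exists>n \<in> set (choices c). cell_nbrs G f c = {fst n, snd n}"
proof -
  obtain i j where ij: "c = M i j" "i \<noteq> j" using c by (auto simp: mem_cells)
  have cv: "c \<in> set model_verts" using c by (rule cells_sub_model_verts)
  define P where "P = {v \<in> set model_verts. (f c, f v) \<in> parcs G}"
  have fr: "frame u v \<Longrightarrow> u \<in> set model_verts \<Longrightarrow> v \<in> set model_verts \<Longrightarrow> (f u, f v) \<in> parcs G" for u v
    using framedD(1)[OF f] by blast
  have eq: "f u = f v \<longleftrightarrow> u = v" if "u \<in> set model_verts" "v \<in> set model_verts" for u v
    using framedD(2)[OF f that] .
  have sq: "a = b \<or> u = v" if "(f a, f u) \<in> parcs G" "(f a, f v) \<in> parcs G"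
      "(f b, f u) \<in> parcs G" "(f b, f v) \<in> parcs G" "a \<in> set model_verts" "b \<in> set model_verts" "u \<in> set model_verts" "v \<in> set model_verts"
    for a b u v using no_square[OF nsc that(1-4)] eq that(5-8) by blast
  have "f ` P = nbhd G (f c)"
  proof
    show "f ` P \<subseteq> nbhd G (f c)" by (auto simp: P_def nbhd_def)
    show "nbhd G (f c) \<subseteq> f ` P"
    proof
      fix p assume p: "p \<in> nbhd G (f c)"
      then have "p \<in> pverts G" using nbhd_sub by blast
      then have "p \<in> f ` set model_verts" using f by (simp add: framed_def bij_betw_def)
      then obtain v where "v \<in> set model_verts" "p = f v" by blast
      then show "p \<in> f ` P" using p by (auto simp: P_def nbhd_def)
    qed
  qed
  moreover have "inj_on f P" using eq by (auto simp: inj_on_def P_def)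
  ultimately have cP: "card P = 4" using reg framedD(3)[OF f cv] card_image by metis
  \<comment> \<open>The four row vertices already exhaust the neighbourhood of \<open>X\<close>.\<close>
  have notX: "X \<notin> P"
  proof
    assume "X \<in> P"
    then have "(f c, f X) \<in> parcs G" by (simp add: P_def)
    then have *: "f c \<in> nbhd G (f X)" using sym_arc[of "f c" "f X"] by (simp add: nbhd_def)
    have "(f ` R ` UNIV) \<subseteq> nbhd G (f X)" using fr[of X] by (auto simp: nbhd_def)
    moreover have "card (f ` R ` UNIV) = 4"
      using eq by (subst card_image; (subst card_image)?) (auto simp: inj_on_def card_ix)
    ultimately have "f ` R ` UNIV = nbhd G (f X)"
      using reg framedD(3)[OF f, of X] finite_nbhd by (intro card_subset_eq) auto
    then obtain k where "f c = f (R k)" using * by blast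
    then show False using eq[OF cv, of "R k"] ij by simp
  qed
  have notY: "Y \<notin> P"
  proof
    assume "Y \<in> P"
    then have "(f c, f Y) \<in> parcs G" by (simp add: P_def)
    then have *: "f c \<in> nbhd G (f Y)" using sym_arc[of "f c" "f Y"] by (simp add: nbhd_def)
    have "(f ` C ` UNIV) \<subseteq> nbhd G (f Y)" using fr[of Y] by (auto simp: nbhd_def)
    moreover have "card (f ` C ` UNIV) = 4"
      using eq by (subst card_image; (subst card_image)?) (auto simp: inj_on_def card_ix)
    ultimately have "f ` C ` UNIV = nbhd G (f Y)"
      using reg framedD(3)[OF f, of Y] finite_nbhd by (intro card_subset_eq) auto
    then obtain k where "f c = f (C k)" using * by blast
    then show False using eq[OF cv, of "C k"] ij by simp
  qed
  \<comment> \<open>A second row vertex next to \<open>c\<close> would close a square with \<open>R i\<close> and \<open>X\<close>.\<close>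
  have onlyR: "k = i" if "R k \<in> P" for k
    using sq[of c "R k" "R i" X] fr[of c "R i"] fr[of X "R k"] fr[of X "R i"] that cv ij
    by (auto simp: P_def)
  have onlyC: "k = j" if "C k \<in> P" for k
    using sq[of c "C k" "C j" Y] fr[of c "C j"] fr[of Y "C k"] fr[of Y "C j"] that cv ij
    by (auto simp: P_def)
  have P: "P = {R i, C j} \<union> cell_nbrs G f c"
  proof
    show "P \<subseteq> {R i, C j} \<union> cell_nbrs G f c"
    proof
      fix v assume "v \<in> P"
      then show "v \<in> {R i, C j} \<union> cell_nbrs G f c"
        using notX notY onlyR onlyC by (cases v) (auto simp: cell_nbrs_def P_def mem_cells)
    qed
    show "{R i, C j} \<union> cell_nbrs G f c \<subseteq> P"
      using fr[of c "R i"] fr[of c "C j"] cv ij cells_sub_model_verts by (auto simp: cell_nbrs_def P_def)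
  qed
  have "card P = card {R i, C j} + card (cell_nbrs G f c)"
    unfolding P
  proof (rule card_Un_disjoint)
    show "finite (cell_nbrs G f c)" unfolding cell_nbrs_def by simp
  qed (auto simp: cell_nbrs_def mem_cells)
  then have "card (cell_nbrs G f c) = 2" using cP by simp
  then obtain a b where ab: "cell_nbrs G f c = {a, b}" "a \<noteq> b" by (auto simp: card_2_iff)
  have cell: "d \<in> set cells" "(f c, f d) \<in> parcs G" "(f d, f c) \<in> parcs G" if "d \<in> {a, b}" for d
    using that sym_arc[of "f c" "f d"] unfolding ab(1)[symmetric] by (auto simp: cell_nbrs_def)
  have comp: "compatible c d" if d: "d \<in> {a, b}" for d
  proof -
    obtain k l where kl: "d = M k l" "k \<noteq> l" using cell(1)[OF d] by (auto simp: mem_cells)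
    have "k \<noteq> i"
    proof
      assume "k = i"
      then show False
        using no_triangle[OF nsc cell(2)[OF d], of "f (R i)"] fr[of d "R i"] fr[of "R i" c] kl ij by auto
    qed
    moreover have "l \<noteq> j"
    proof
      assume "l = j"
      then show False
        using no_triangle[OF nsc cell(2)[OF d], of "f (C j)"] fr[of d "C j"] fr[of "C j" c] kl ij by auto
    qed
    ultimately show ?thesis using ij kl by auto
  qed
  have "compatible a b"
  proof -
    obtain k l k' l' where kl: "a = M k l" "k \<noteq> l" "b = M k' l'" "k' \<noteq> l'"
      using cell(1)[of a] cell(1)[of b] by (auto simp: mem_cells)
    have "k \<noteq> k'"
    proof
      assume "k = k'"
      then show False
        using sq[of c a b "R k"] cell(2)[of a] cell(2)[of b] fr[of "R k" a] fr[of "R k" b] kl cv ij ab(2)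
        by auto
    qed
    moreover have "l \<noteq> l'"
    proof
      assume "l = l'"
      then show False
        using sq[of c a b "C l"] cell(2)[of a] cell(2)[of b] fr[of "C l" a] fr[of "C l" b] kl cv ij ab(2)
        by auto
    qed
    ultimately show ?thesis using kl by simp
  qed
  moreover from this have "compatible b a" using cell(1)[of a] cell(1)[of b] by (auto simp: mem_cells)
  moreover have "(a, b) \<in> set (pairs (filter (compatible c) cells)) \<or>
      (b, a) \<in> set (pairs (filter (compatible c) cells))"
    by (rule pairs_complete) (use cell(1) comp ab(2) in auto)
  ultimately show ?thesis using ab(1) by (auto simp: choices_def)
qed

lemma cell_nbrs_agree:
  assumes nsc: "no_short_cycle G" and f: "framed G f"
    and n: "cell_nbrs G f c = {fst n, snd n}" "n \<in> set (choices c)"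
    and k: "cell_nbrs G f d = {fst k, snd k}" "k \<in> set (choices d)"
    and cd: "c \<in> set cells" "d \<in> set cells" "c \<noteq> d"
  shows "agree c n d k"
proof -
  obtain a b e g where ab: "n = (a, b)" "k = (e, g)" by (cases n; cases k) 
  have ne: "a \<noteq> b" "e \<noteq> g" using n(2) k(2) ab by (auto simp: choices_def elim: compatible.elims)
  have D: "v \<in> {a, b} \<longleftrightarrow> v \<in> set cells \<and> (f c, f v) \<in> parcs G"
      "v \<in> {e, g} \<longleftrightarrow> v \<in> set cells \<and> (f d, f v) \<in> parcs G" for v
    using n(1) k(1) unfolding ab by (auto simp: cell_nbrs_def)
  have sym: "d \<in> {a, b} \<longleftrightarrow> c \<in> {e, g}"
    unfolding D using cd sym_arc by blast
  have tri: "v \<notin> {e, g}" if "d \<in> {a, b}" "v \<in> {a, b}" for v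
  proof
    assume "v \<in> {e, g}"
    then have "(f c, f d) \<in> parcs G" "(f d, f v) \<in> parcs G" "(f v, f c) \<in> parcs G"
      using that unfolding D using sym_arc by blast+
    then show False using no_triangle[OF nsc] by blast
  qed
  have sq: "\<not> (a \<in> {e, g} \<and> b \<in> {e, g})"
  proof
    assume "a \<in> {e, g} \<and> b \<in> {e, g}"
    then have "(f c, f a) \<in> parcs G" "(f c, f b) \<in> parcs G" "(f d, f a) \<in> parcs G" "(f d, f b) \<in> parcs G"
      "a \<in> set cells" "b \<in> set cells"
      using D by blast+
    then show False
      using no_square[OF nsc, of "f c" "f a" "f b" "f d"] framedD(2)[OF f] cells_sub_model_verts cd ne(1) by blast
  qed
  show ?thesis unfolding ab using sym tri[of a] tri[of b] sq ne by auto
qed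

lemma exists_labelling:
  assumes reg: "\<And>v. v \<in> pverts G \<Longrightarrow> card (nbhd G v) = 4"
    and nsc: "no_short_cycle G" and f: "framed G f"
  shows "\<exists>g h. bij_betw h (set model_verts) (pverts G) \<and>
    (\<forall>u \<in> set model_verts. \<forall>v \<in> set model_verts. v \<in> set (nbrs_via (ring_nbrs g) u) \<longrightarrow> (h u, h v) \<in> parcs G)"
proof -
  obtain N where N: "\<And>c. c \<in> set cells \<Longrightarrow> N c \<in> set (choices c) \<and> cell_nbrs G f c = {fst (N c), snd (N c)}"
    using cell_nbrs_choice[OF reg nsc f] by metis
  have "is_ring syms (map (\<lambda>c. (c, N c)) (rev agenda @ []))"
  proof (rule search_sound)
    show "search syms (map (\<lambda>c. (c, choices c)) agenda) (map (\<lambda>c. (c, N c)) [])" using search_complete by simp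
    show "agree c (N c) d (N d)" if "c \<in> set agenda \<union> set []" "d \<in> set agenda \<union> set []" "c \<noteq> d" for c d
      using that N cell_nbrs_agree[OF nsc f] by (simp add: set_agenda)
  qed (use N distinct_agenda in \<open>auto simp: set_agenda\<close>)
  then obtain g s where s: "s \<in> set syms"
    and car: "carries g s (map (\<lambda>c. (c, N c)) (rev agenda))"
    using is_ringD by fastforce
  define orig where "orig = the_inv_into (set model_verts) (act s)"
  have inj: "inj_on (act s) (set model_verts)" using act_inj[OF s] by (rule inj_on_subset) simp
  have orig: "orig v \<in> set model_verts" "act s (orig v) = v" if "v \<in> set model_verts" for v
    using that inj act_image[OF s] unfolding orig_def
    by (auto intro!: the_inv_into_into f_the_inv_into_f)
  have "bij_betw orig (set model_verts) (set model_verts)"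
    using bij_betw_the_inv_into[of "act s" "set model_verts" "set model_verts"] inj act_image[OF s]
    by (simp add: bij_betw_def orig_def)
  then have bij: "bij_betw (f \<circ> orig) (set model_verts) (pverts G)"
    by (rule bij_betw_trans) (use f in \<open>simp add: framed_def\<close>)
  have "(f (orig u), f (orig v)) \<in> parcs G"
    if uv: "u \<in> set model_verts" "v \<in> set model_verts" "v \<in> set (nbrs_via (ring_nbrs g) u)" for u v
  proof (cases "frame u v")
    case True
    then have "frame (orig u) (orig v)" using frame_act[OF s, of "orig u" "orig v"] orig uv by simp
    then show ?thesis using framedD(1)[OF f] orig uv by blast
  next
    case False
    with nbrs_viaD[OF uv(3)] uv(1) have u: "u \<in> set cells" and v: "v \<in> {fst (ring_nbrs g u), snd (ring_nbrs g u)}"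
      by (auto simp: mem_cells image_iff) (metis mem_model_verts(5) vert.exhaust)+
    have c: "orig u \<in> set cells" using act_cell[of s "orig u"] orig uv(1) u by simp
    have "same_pair (act s (fst (N (orig u))), act s (snd (N (orig u)))) (ring_nbrs g (act s (orig u)))"
      using car c set_agenda by (intro carriesD) auto
    then have "v \<in> {act s (fst (N (orig u))), act s (snd (N (orig u)))}"
      using v orig(2)[OF uv(1)] by (cases "ring_nbrs g u") auto
    then have "orig v \<in> {fst (N (orig u)), snd (N (orig u))}"
      using injD[OF act_inj[OF s]] orig(2)[OF uv(2)] by (metis insert_iff singletonD)
    then show ?thesis using N[OF c] by (auto simp: cell_nbrs_def)
  qed
  then show ?thesis using bij by (intro exI[of _ g] exI[of _ "f \<circ> orig"]) simp
qed

end

section \<open>Four graphs\<close>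

definition model_nbrs :: "ix \<Rightarrow> vert \<Rightarrow> vert list" where "model_nbrs g = nbrs_via (ring_nbrs g)"

text \<open>
  The last clause expresses the girth condition at one vertex: the vertex, its four neighbours and
  their twelve further neighbours are all different.
\<close>

definition locally_ok :: "ix \<Rightarrow> bool" where
  "locally_ok g \<longleftrightarrow> list_all (\<lambda>v. length (model_nbrs g v) = 4 \<and>
     list_all (\<lambda>w. w \<in> set model_verts \<and> v \<in> set (model_nbrs g w)) (model_nbrs g v) \<and>
     distinct (v # model_nbrs g v @ concat (map (\<lambda>w. remove1 v (model_nbrs g w)) (model_nbrs g v)))) model_verts"

lemma locally_ok_ix: "locally_ok I0" "locally_ok I1" "locally_ok I2" "locally_ok I3"
  by code_simp+

lemma distinct_ixs: "distinct ixs" by (simp add: ixs_def)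

definition model :: "ix \<Rightarrow> vert pair_pre_digraph" where
  "model g = \<lparr>pverts = set model_verts, parcs = {(u, v). u \<in> set model_verts \<and> v \<in> set (model_nbrs g u)}\<rparr>"

lemma locally_ok: "locally_ok g"
  by (cases g) (simp_all only: locally_ok_ix)

lemma model_nbrs_facts:
  assumes "v \<in> set model_verts"
  shows "length (model_nbrs g v) = 4"
    and "w \<in> set (model_nbrs g v) \<Longrightarrow> w \<in> set model_verts"
    and "w \<in> set (model_nbrs g v) \<Longrightarrow> v \<in> set (model_nbrs g w)"
    and "distinct (v # model_nbrs g v @ concat (map (\<lambda>w. remove1 v (model_nbrs g w)) (model_nbrs g v)))"
proof -
  from locally_ok[of g] assms have *: "length (model_nbrs g v) = 4 \<and>
     list_all (\<lambda>w. w \<in> set model_verts \<and> v \<in> set (model_nbrs g w)) (model_nbrs g v) \<and>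
     distinct (v # model_nbrs g v @ concat (map (\<lambda>w. remove1 v (model_nbrs g w)) (model_nbrs g v)))"
    unfolding locally_ok_def list_all_iff[of _ model_verts] by (rule bspec)
  show "length (model_nbrs g v) = 4" using * by (rule conjunct1)
  show "distinct (v # model_nbrs g v @ concat (map (\<lambda>w. remove1 v (model_nbrs g w)) (model_nbrs g v)))"
    using * by (elim conjE)
  assume w: "w \<in> set (model_nbrs g v)"
  have "w \<in> set model_verts \<and> v \<in> set (model_nbrs g w)"
    using conjunct1[OF conjunct2[OF *]] w unfolding list_all_iff by (rule bspec)
  then show "w \<in> set model_verts" "v \<in> set (model_nbrs g w)" by (rule conjunct1, rule conjunct2)
qed

lemma nbhd_model: "v \<in> set model_verts \<Longrightarrow> nbhd (model g) v = set (model_nbrs g v)"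
  by (auto simp: nbhd_def model_def)

lemma model_arcs: "(u, v) \<in> parcs (model g) \<longleftrightarrow> u \<in> set model_verts \<and> v \<in> set (model_nbrs g u)"
  by (simp add: model_def)

lemma pverts_model: "pverts (model g) = set model_verts"
  by (simp add: model_def)

lemma pair_graph_model: "pair_graph (model g)"
proof
  show arcs: "fst e \<in> pverts (model g)" "snd e \<in> pverts (model g)" if "e \<in> parcs (model g)" for e
    using that model_nbrs_facts(2) by (cases e, auto simp: model_arcs pverts_model)+
  show "finite (pverts (model g))" by (simp add: pverts_model)
  have "parcs (model g) \<subseteq> set model_verts \<times> set model_verts" using arcs by (auto simp: pverts_model)
  then show "finite (parcs (model g))" using finite_subset by blast
  show "fst e \<noteq> snd e" if "e \<in> parcs (model g)" for e
    using that model_nbrs_facts(4)[of "fst e" g] by (cases e) (auto simp: model_arcs)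
  show "symmetric (with_proj (model g))"
  proof -
    have "(v, u) \<in> parcs (model g)" if "(u, v) \<in> parcs (model g)" for u v
      using that model_nbrs_facts(2)[of u v g] model_nbrs_facts(3)[of u v g] by (simp add: model_arcs)
    then show ?thesis by (auto simp: symmetric_def sym_def)
  qed
qed

lemma regular_model: "regular_graph 4 (model g)"
  unfolding regular_graph_iff
proof (intro conjI ballI pair_graph_model)
  fix v assume "v \<in> pverts (model g)"
  then have v: "v \<in> set model_verts" by (simp add: pverts_model)
  then have "distinct (model_nbrs g v)" using model_nbrs_facts(4)[OF v] by auto
  then show "card (nbhd (model g) v) = 4"
    using model_nbrs_facts(1)[OF v] by (simp add: nbhd_model[OF v] distinct_card)
qed

lemma distinct_concat_map_disjoint:
  "distinct (concat (map L xs)) \<Longrightarrow> u \<in> set xs \<Longrightarrow> v \<in> set xs \<Longrightarrow> u \<noteq> v \<Longrightarrow> b \<in> set (L u) \<Longrightarrow> b \<notin> set (L v)"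
  by (induction xs) auto

lemma no_short_cycle_model: "no_short_cycle (model g)"
proof -
  have tri: "(w, u) \<notin> parcs (model g)" if "(u, v) \<in> parcs (model g)" "(v, w) \<in> parcs (model g)" for u v w
  proof
    assume wu: "(w, u) \<in> parcs (model g)"
    have u: "u \<in> set model_verts" and v: "v \<in> set (model_nbrs g u)" "v \<in> set model_verts"
      and w: "w \<in> set (model_nbrs g v)" "w \<in> set model_verts" "w \<in> set (model_nbrs g u)"
      using that wu model_nbrs_facts(3)[of w u g] by (auto simp: model_arcs)
    have "w \<noteq> u" using model_nbrs_facts(4)[OF u, of g] w(3) by auto
    then have "w \<in> set (concat (map (\<lambda>w. remove1 u (model_nbrs g w)) (model_nbrs g u)))"
      using v(1) w(1) by auto
    then show False using model_nbrs_facts(4)[OF u, of g] w(3) by auto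
  qed
  have sq: "a = b \<or> u = v" if "(a, u) \<in> parcs (model g)" "(a, v) \<in> parcs (model g)"
      "(b, u) \<in> parcs (model g)" "(b, v) \<in> parcs (model g)" for u v a b
  proof (rule ccontr)
    assume ne: "\<not> (a = b \<or> u = v)"
    have a: "a \<in> set model_verts" and uv: "u \<in> set (model_nbrs g a)" "v \<in> set (model_nbrs g a)"
      and b: "b \<in> set (model_nbrs g u)" "b \<in> set (model_nbrs g v)"
      using that model_nbrs_facts(3)[of b _ g] by (auto simp: model_arcs)
    let ?L = "\<lambda>w. remove1 a (model_nbrs g w)"
    have d: "distinct (concat (map ?L (model_nbrs g a)))" using model_nbrs_facts(4)[OF a, of g] by auto
    have "b \<in> set (?L u)" "b \<in> set (?L v)" using ne b by auto
    then show False using distinct_concat_map_disjoint[OF d uv] ne by blast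
  qed
  show ?thesis unfolding no_short_cycle_def using tri sq by blast
qed

lemma model_nbrs_simps [simp]:
  "set (model_nbrs g X) = range R"
  "set (model_nbrs g Y) = range C"
  "set (model_nbrs g (R i)) = insert X {M i j |j. j \<noteq> i}"
  by (auto simp: model_nbrs_def set_ixs set_remove1_eq distinct_ixs)

lemma far_model: "far (model g) X Y"
proof -
  have no: "Y \<notin> set (model_nbrs g v)" if "v \<in> set model_verts" "v \<notin> range C" for v
    using model_nbrs_facts(3)[OF that(1), of Y g] that(2) by auto
  have "(b, Y) \<notin> parcs (model g)" if "(X, a) \<in> parcs (model g)" "(a, b) \<in> parcs (model g)" for a b
  proof -
    have "b \<in> set model_verts" using that model_nbrs_facts(2)[of a b g] by (simp add: model_arcs)
    moreover have "b \<notin> range C" using that by (auto simp: model_arcs)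
    ultimately show ?thesis using no[of b] by (simp add: model_arcs)
  qed
  moreover have "(a, Y) \<notin> parcs (model g)" if "(X, a) \<in> parcs (model g)" for a
    using that no[of a] by (auto simp: model_arcs)
  ultimately show ?thesis
    unfolding far_def using no[of X] by (auto simp: model_arcs pverts_model)
qed

text \<open>
  \<open>X\<close>, two adjacent cells and their row vertices form a pentagon.
\<close>

lemma five_cycle_model:
  obtains a b c d e where "(a, b) \<in> parcs (model g)" "(b, c) \<in> parcs (model g)" "(c, d) \<in> parcs (model g)"
    "(d, e) \<in> parcs (model g)" "(e, a) \<in> parcs (model g)" "distinct [a, b, c, d, e]"
proof -
  define i where "i = (if g = I0 \<or> g = I1 then I1 else I2)"
  have "M i I0 \<in> set (model_nbrs g (M I0 I1))"
    unfolding i_def by (cases g; simp only:; code_simp)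
  moreover have "R i \<in> set (model_nbrs g (M i I0))" by (simp add: model_nbrs_def)
  ultimately show thesis
    using model_nbrs_facts(3)[of X "R i" g]
    by (intro that[of X "R I0" "M I0 I1" "M i I0" "R i"]) (auto simp: model_arcs i_def)
qed


section \<open>Automorphism groups\<close>

lemma carrier_aut_group:
  "carrier (aut_group G) = {f \<in> Bij (pverts G). \<forall>u \<in> pverts G. \<forall>v \<in> pverts G.
        (f u, f v) \<in> parcs G \<longleftrightarrow> (u, v) \<in> parcs G}"
  by (simp add: aut_group_def)

lemma finite_aut_group:
  assumes "finite (pverts G)"
  shows "finite (carrier (aut_group G))"
proof (rule finite_subset)
  show "carrier (aut_group G) \<subseteq> pverts G \<rightarrow>\<^sub>E pverts G"
    by (auto simp: carrier_aut_group Bij_def bij_betw_def PiE_def)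
  show "finite (pverts G \<rightarrow>\<^sub>E pverts G)" using assms by (intro finite_PiE) auto
qed

text \<open>
  Conjugation by the isomorphism embeds one automorphism group into the other.
\<close>

lemma order_aut_group_le:
  assumes f: "bij_betw f (pverts G) (pverts H)" and fin: "finite (pverts H)"
    and iff: "\<And>u v. u \<in> pverts G \<Longrightarrow> v \<in> pverts G \<Longrightarrow> (f u, f v) \<in> parcs H \<longleftrightarrow> (u, v) \<in> parcs G"
  shows "order (aut_group G) \<le> order (aut_group H)"
proof -
  define e where "e = the_inv_into (pverts G) f"
  have e: "bij_betw e (pverts H) (pverts G)"
    unfolding e_def by (rule bij_betw_the_inv_into[OF f])
  have ef: "e (f u) = u" if "u \<in> pverts G" for u
    using f that by (auto simp: e_def bij_betw_def the_inv_into_f_f)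
  have fe: "f (e v) = v" "e v \<in> pverts G" if "v \<in> pverts H" for v
    using f that e by (auto simp: e_def bij_betw_def f_the_inv_into_f)
  have fV: "f u \<in> pverts H" if "u \<in> pverts G" for u using f that by (auto simp: bij_betw_def)
  let ?c = "\<lambda>h. \<lambda>v \<in> pverts H. f (h (e v))"
  have hV: "h u \<in> pverts G" if "h \<in> carrier (aut_group G)" "u \<in> pverts G" for h u
    using that by (auto simp: carrier_aut_group Bij_def bij_betw_def)
  have "card (carrier (aut_group G)) \<le> card (carrier (aut_group H))"
  proof (rule card_inj_on_le[of ?c])
    show "inj_on ?c (carrier (aut_group G))"
    proof (rule inj_onI)
      fix h k assume hk: "h \<in> carrier (aut_group G)" "k \<in> carrier (aut_group G)" "?c h = ?c k"
      have "h u = k u" if u: "u \<in> pverts G" for u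
      proof -
        have "f (h u) = f (k u)" using fun_cong[OF hk(3), of "f u"] fV[OF u] ef[OF u] by simp
        then show ?thesis using ef[OF hV[OF hk(1) u]] ef[OF hV[OF hk(2) u]] by metis
      qed
      then show "h = k" using hk(1,2)
        by (intro extensionalityI[of h "pverts G" k]) (auto simp: carrier_aut_group Bij_def)
    qed
    show "?c ` carrier (aut_group G) \<subseteq> carrier (aut_group H)"
    proof (intro image_subsetI)
      fix h assume h: "h \<in> carrier (aut_group G)"
      have "bij_betw h (pverts G) (pverts G)" using h by (auto simp: carrier_aut_group Bij_def)
      then have "bij_betw (f \<circ> (h \<circ> e)) (pverts H) (pverts H)"
        using e f by (intro bij_betw_trans)
      then have "bij_betw (?c h) (pverts H) (pverts H)"
        by (rule bij_betw_cong[THEN iffD1, rotated]) simp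
      moreover have "(?c h u, ?c h v) \<in> parcs H \<longleftrightarrow> (u, v) \<in> parcs H"
        if uv: "u \<in> pverts H" "v \<in> pverts H" for u v
      proof -
        note u = fe(2)[OF uv(1)] and v = fe(2)[OF uv(2)]
        have "(?c h u, ?c h v) \<in> parcs H \<longleftrightarrow> (h (e u), h (e v)) \<in> parcs G"
          using iff[OF hV[OF h u] hV[OF h v]] uv by simp
        also have "\<dots> \<longleftrightarrow> (e u, e v) \<in> parcs G" using h u v by (simp add: carrier_aut_group)
        also have "\<dots> \<longleftrightarrow> (f (e u), f (e v)) \<in> parcs H" using iff[OF u v] by simp
        finally show ?thesis by (simp only: fe(1)[OF uv(1)] fe(1)[OF uv(2)])
      qed
      ultimately show "?c h \<in> carrier (aut_group H)"
        by (simp add: carrier_aut_group Bij_def)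
    qed
    show "finite (carrier (aut_group H))" by (rule finite_aut_group[OF fin])
  qed
  then show ?thesis by (simp add: order_def)
qed

lemma digraph_iso_order_aut_group:
  assumes G: "pair_graph G" and H: "pair_graph H" and iso: "digraph_iso (with_proj G) (with_proj H)"
  shows "order (aut_group G) = order (aut_group H)"
proof -
  interpret G: pair_graph G by fact
  interpret H: pair_graph H by fact
  obtain f where f: "bij_betw f (pverts G) (pverts H)"
    and iff: "\<And>u v. u \<in> pverts G \<Longrightarrow> v \<in> pverts G \<Longrightarrow> (f u, f v) \<in> parcs H \<longleftrightarrow> (u, v) \<in> parcs G"
    using iso digraph_iso_pair_iff[OF G.pair_wf_digraph H.pair_wf_digraph] by blast
  define e where "e = the_inv_into (pverts G) f"
  have e: "bij_betw e (pverts H) (pverts G)"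
    unfolding e_def by (rule bij_betw_the_inv_into[OF f])
  have fe: "f (e v) = v" "e v \<in> pverts G" if "v \<in> pverts H" for v
    using f that e by (auto simp: e_def bij_betw_def f_the_inv_into_f)
  show ?thesis
  proof (rule antisym)
    show "order (aut_group G) \<le> order (aut_group H)"
      using f H.pair_finite_verts iff by (rule order_aut_group_le)
    show "order (aut_group H) \<le> order (aut_group G)"
    proof (rule order_aut_group_le[OF e G.pair_finite_verts])
      fix u v assume uv: "u \<in> pverts H" "v \<in> pverts H"
      show "(e u, e v) \<in> parcs G \<longleftrightarrow> (u, v) \<in> parcs H"
        using iff[OF fe(2)[OF uv(1)] fe(2)[OF uv(2)]] by (simp add: fe(1) uv)
    qed
  qed
qed

fun weave :: "ix list \<Rightarrow> vert list \<Rightarrow> vert list" where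
  "weave seen (M i j # cs) =
    (if i \<in> set seen then M i j # weave seen cs else M i j # R i # weave (i # seen) cs)"
| "weave seen _ = []"

text \<open>
  Automorphisms are constructed one vertex at a time in this order. It follows the ring and places each
  row vertex as soon as a cell of its row has been placed, so that cycles of length 5 close early and
  prune the search.
\<close>

definition itinerary :: "ix \<Rightarrow> vert list" where
  "itinerary g = X # R I0 # weave [I0] (ring g) @ map C ixs @ [Y]"

text \<open>
  Pairs each vertex of the itinerary with its neighbours that have been placed before it.
\<close>

fun plan :: "ix \<Rightarrow> vert list \<Rightarrow> vert list \<Rightarrow> (vert \<times> vert list) list" where
  "plan g seen [] = []"
| "plan g seen (v # us) = (v, filter (\<lambda>w. w \<in> set seen) (model_nbrs g v)) # plan g (v # seen) us"

fun image_of :: "(vert \<times> vert) list \<Rightarrow> vert \<Rightarrow> vert" where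
  "image_of [] v = v"
| "image_of ((u, w) # ps) v = (if u = v then w else image_of ps v)"

fun used :: "(vert \<times> vert) list \<Rightarrow> vert \<Rightarrow> bool" where
  "used [] w \<longleftrightarrow> False"
| "used ((u, w') # ps) w \<longleftrightarrow> w' = w \<or> used ps w"

fun joined :: "ix \<Rightarrow> (vert \<times> vert) list \<Rightarrow> vert list \<Rightarrow> vert \<Rightarrow> bool" where
  "joined g ps [] w \<longleftrightarrow> True"
| "joined g ps (q # qs) w \<longleftrightarrow> w \<in> set (model_nbrs g (image_of ps q)) \<and> joined g ps qs w"

definition candidates where
  "candidates g ps qs = (case qs of [] \<Rightarrow> model_verts | q # _ \<Rightarrow> model_nbrs g (image_of ps q))"

text \<open>
  The state \<open>ps\<close> lists the images chosen so far. The next vertex can only be sent to a neighbour of the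
  image of its first placed neighbour, to an unused vertex, and consistently with all edges to placed
  vertices.
\<close>

function (sequential) autos :: "ix \<Rightarrow> (vert \<times> vert list) list \<Rightarrow> (vert \<times> vert) list \<Rightarrow> (vert \<times> vert) list list"
  and autos_from where
  "autos g [] ps = [ps]"
| "autos g ((v, qs) # rest) ps = autos_from g v qs (candidates g ps qs) rest ps"
| "autos_from g v qs [] rest ps = []"
| "autos_from g v qs (w # ws) rest ps =
    (if \<not> used ps w \<and> joined g ps (tl qs) w then autos g rest ((v, w) # ps) @ autos_from g v qs ws rest ps
     else autos_from g v qs ws rest ps)"
  by pat_completeness auto
termination
  by (relation "measures
      [\<lambda>z. case z of Inl (_, rest, _) \<Rightarrow> length rest | Inr (_, _, _, _, rest, _) \<Rightarrow> length rest,
       \<lambda>z. case z of Inl _ \<Rightarrow> 0 | Inr (_, _, _, ws, _, _) \<Rightarrow> Suc (length ws)]") auto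


lemma used_iff: "used ps w \<longleftrightarrow> w \<in> snd ` set ps"
  by (induction ps w rule: used.induct) auto

lemma joined_iff: "joined g ps qs w \<longleftrightarrow> (\<forall>q \<in> set qs. w \<in> set (model_nbrs g (image_of ps q)))"
  by (induction qs) auto

lemma image_of_graph: "v \<in> set us \<Longrightarrow> image_of (map (\<lambda>v. (v, f v)) us) v = f v"
  by (induction us) auto

lemma image_of_keys: "distinct (map fst ps) \<Longrightarrow> map (\<lambda>v. (v, image_of ps v)) (map fst ps) = ps"
proof (induction ps)
  case (Cons p ps)
  obtain u w where p: "p = (u, w)" by (cases p)
  have u: "u \<notin> set (map fst ps)" and IH: "map (\<lambda>v. (v, image_of ps v)) (map fst ps) = ps"
    using Cons p by auto
  have "map (\<lambda>v. (v, image_of ((u, w) # ps) v)) (map fst ps) = map (\<lambda>v. (v, image_of ps v)) (map fst ps)"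
    by (rule map_cong[OF refl]) (use u in auto)
  then have "map (\<lambda>v. (v, image_of ((u, w) # ps) v)) (map fst ps) = ps" unfolding IH .
  then show ?case unfolding p by simp
qed simp

lemma autos_fromI:
  "w \<in> set ws \<Longrightarrow> \<not> used ps w \<Longrightarrow> joined g ps (tl qs) w \<Longrightarrow>
   set (autos g rest ((v, w) # ps)) \<subseteq> set (autos_from g v qs ws rest ps)"
  by (induction ws) auto

text \<open>
  The tests made for a vertex concern only its edges to placed vertices and the images already used, all
  of which \<open>f\<close> respects; so the branch that follows \<open>f\<close> is never cut.
\<close>

lemma autos_complete:
  assumes inj: "inj_on f (set model_verts)" and V: "\<And>v. v \<in> set model_verts \<Longrightarrow> f v \<in> set model_verts"
    and hom: "\<And>u v. u \<in> set model_verts \<Longrightarrow> v \<in> set (model_nbrs g u) \<Longrightarrow> f v \<in> set (model_nbrs g (f u))"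
    and us: "distinct (us @ seen)" "set (us @ seen) \<subseteq> set model_verts"
  shows "map (\<lambda>v. (v, f v)) (rev us @ seen) \<in> set (autos g (plan g seen us) (map (\<lambda>v. (v, f v)) seen))"
  using us
proof (induction us arbitrary: seen)
  case (Cons v us)
  let ?ps = "map (\<lambda>v. (v, f v)) seen"
  let ?qs = "filter (\<lambda>w. w \<in> set seen) (model_nbrs g v)"
  have v: "v \<in> set model_verts" using Cons.prems by simp
  have q: "f v \<in> set (model_nbrs g (image_of ?ps q))" if "q \<in> set ?qs" for q
    using that hom[of q v] model_nbrs_facts(2,3)[OF v, of q g] by (auto simp: image_of_graph)
  have "f v \<in> set (candidates g ?ps ?qs)"
    using q V[OF v] by (cases ?qs) (auto simp: candidates_def)
  moreover have "\<not> used ?ps (f v)"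
    using Cons.prems inj_on_eq_iff[OF inj] v by (auto simp: used_iff)
  moreover have "joined g ?ps (tl ?qs) (f v)"
  proof -
    have "set (tl xs) \<subseteq> set xs" for xs :: "vert list" by (cases xs) auto
    then show ?thesis unfolding joined_iff using q by blast
  qed
  ultimately have "set (autos g (plan g (v # seen) us) ((v, f v) # ?ps))
      \<subseteq> set (autos g (plan g seen (v # us)) ?ps)"
    by (simp only: plan.simps autos.simps) (rule autos_fromI)
  moreover have "map (\<lambda>v. (v, f v)) (rev us @ (v # seen))
      \<in> set (autos g (plan g (v # seen) us) (map (\<lambda>v. (v, f v)) (v # seen)))"
    by (rule Cons.IH) (use Cons.prems in auto)
  ultimately show ?case by (auto simp del: plan.simps autos.simps)
qed simp

text \<open>
  A check from scratch, by which a listed map is an automorphism independently of how the search found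
  it.
\<close>

definition is_aut :: "ix \<Rightarrow> (vert \<times> vert) list \<Rightarrow> bool" where
  "is_aut g ps \<longleftrightarrow> map fst ps = rev (itinerary g) \<and> distinct (map snd ps) \<and>
     list_all (\<lambda>v. image_of ps v \<in> set model_verts \<and>
       list_all (\<lambda>w. image_of ps w \<in> set (model_nbrs g (image_of ps v))) (model_nbrs g v)) model_verts"

definition auts_counted :: "ix \<Rightarrow> nat \<Rightarrow> (vert \<times> vert) list list \<Rightarrow> bool" where
  "auts_counted g k A \<longleftrightarrow> length A = k \<and> distinct A \<and> list_all (is_aut g) A"

lemma itinerary: "distinct (itinerary g)" "set (itinerary g) = set model_verts"
proof -
  have "list_all (\<lambda>g. distinct (itinerary g) \<and> set (itinerary g) = set model_verts) ixs" by code_simp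
  then have *: "\<forall>g \<in> set ixs. distinct (itinerary g) \<and> set (itinerary g) = set model_verts"
    by (simp only: list_all_iff)
  show "distinct (itinerary g)" "set (itinerary g) = set model_verts" using * by (simp_all add: set_ixs)
qed

lemma order_aut_model:
  assumes "auts_counted g k (autos g (plan g [] (itinerary g)) [])"
  shows "order (aut_group (model g)) = k"
proof -
  define A where "A = autos g (plan g [] (itinerary g)) []"
  have A: "length A = k" "distinct A" and isA: "\<And>ps. ps \<in> set A \<Longrightarrow> is_aut g ps"
    using assms by (auto simp: auts_counted_def A_def list_all_iff)
  let ?tab = "\<lambda>f. map (\<lambda>v. (v, f v)) (rev (itinerary g))"
  have "bij_betw ?tab (carrier (aut_group (model g))) (set A)"
  proof (rule bij_betw_imageI)
    show "inj_on ?tab (carrier (aut_group (model g)))"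
    proof (rule inj_onI)
      fix f h assume fh: "f \<in> carrier (aut_group (model g))" "h \<in> carrier (aut_group (model g))"
        "?tab f = ?tab h"
      then have "f v = h v" if "v \<in> set model_verts" for v
        using that itinerary(2)[of g] by (auto simp: map_eq_conv)
      then show "f = h" using fh(1,2)
        by (intro extensionalityI[of f "set model_verts" h]) (auto simp: carrier_aut_group Bij_def pverts_model)
    qed
    show "?tab ` carrier (aut_group (model g)) = set A"
    proof
      show "?tab ` carrier (aut_group (model g)) \<subseteq> set A"
      proof (intro image_subsetI)
        fix f assume f: "f \<in> carrier (aut_group (model g))"
        then have b: "inj_on f (set model_verts)" "f ` set model_verts = set model_verts"
          by (auto simp: carrier_aut_group Bij_def bij_betw_def pverts_model)
        have hom: "f v \<in> set (model_nbrs g (f u))" if uv: "u \<in> set model_verts" "v \<in> set (model_nbrs g u)" for u v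
        proof -
          have "v \<in> set model_verts" using model_nbrs_facts(2)[OF uv] .
          moreover have "(u, v) \<in> parcs (model g)" using uv by (simp add: model_arcs)
          ultimately have "(f u, f v) \<in> parcs (model g)"
            using f uv(1) by (simp add: carrier_aut_group pverts_model)
          then show ?thesis by (simp add: model_arcs)
        qed
        have "map (\<lambda>v. (v, f v)) (rev (itinerary g) @ [])
            \<in> set (autos g (plan g [] (itinerary g)) (map (\<lambda>v. (v, f v)) []))"
          using b by (intro autos_complete hom) (auto simp: itinerary)
        then show "?tab f \<in> set A" by (simp add: A_def)
      qed
      show "set A \<subseteq> ?tab ` carrier (aut_group (model g))"
      proof
        fix ps assume "ps \<in> set A"
        then have ps: "map fst ps = rev (itinerary g)" "distinct (map snd ps)"
          and V: "\<And>v. v \<in> set model_verts \<Longrightarrow> image_of ps v \<in> set model_verts"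
          and E: "\<And>v w. v \<in> set model_verts \<Longrightarrow> w \<in> set (model_nbrs g v) \<Longrightarrow> image_of ps w \<in> set (model_nbrs g (image_of ps v))"
          using isA[of ps] by (auto simp: is_aut_def list_all_iff)
        let ?f = "\<lambda>v \<in> set model_verts. image_of ps v"
        have tab: "?tab (image_of ps) = ps"
          using image_of_keys[of ps] ps(1) itinerary(1)[of g] by simp
        have "map (image_of ps) (rev (itinerary g)) = map snd ps"
          using arg_cong[OF tab, of "map snd"] by (simp add: comp_def)
        then have "inj_on (image_of ps) (set model_verts)"
          using ps(2) itinerary(2)[of g] by (metis distinct_map set_rev)
        then have inj: "inj_on ?f (set model_verts)" by (simp add: inj_on_def)
        then have bij: "bij_betw ?f (set model_verts) (set model_verts)"
          unfolding bij_betw_def using V by (intro conjI endo_inj_surj) auto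
        have "(?f u, ?f v) \<in> parcs (model g)" if "(u, v) \<in> parcs (model g)" for u v
          using that V E model_nbrs_facts(2) by (auto simp: model_arcs)
        then have "(?f u, ?f v) \<in> parcs (model g) \<longleftrightarrow> (u, v) \<in> parcs (model g)"
          if "u \<in> set model_verts" "v \<in> set model_verts" for u v
          using regular_hom_iff[OF regular_model regular_model, of ?f g g] bij that
          by (simp only: pverts_model)
        then have "?f \<in> carrier (aut_group (model g))" (is ?in)
          using bij by (simp add: carrier_aut_group Bij_def pverts_model)
        have "?tab ?f = ps"
        proof -
          have "?tab ?f = ?tab (image_of ps)"
            by (rule map_cong[OF refl]) (simp add: itinerary(2))
          then show ?thesis using tab by simp
        qed
        then have "ps = ?tab ?f" by (rule sym)
        then show "ps \<in> ?tab ` carrier (aut_group (model g))" using \<open>?in\<close> by (rule image_eqI)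
      qed
    qed
  qed
  then show ?thesis
    using A by (simp add: order_def bij_betw_same_card distinct_card)
qed

lemma auts_counted_I0: "auts_counted I0 1 (autos I0 (plan I0 [] (itinerary I0)) [])"
  by code_simp

lemma auts_counted_I1: "auts_counted I1 2 (autos I1 (plan I1 [] (itinerary I1)) [])"
  by code_simp

lemma auts_counted_I2: "auts_counted I2 4 (autos I2 (plan I2 [] (itinerary I2)) [])"
  by code_simp

lemma auts_counted_I3: "auts_counted I3 8 (autos I3 (plan I3 [] (itinerary I3)) [])"
  by code_simp

lemma order_aut_group_model:
  "order (aut_group (model I0)) = 1" "order (aut_group (model I1)) = 2"
  "order (aut_group (model I2)) = 4" "order (aut_group (model I3)) = 8"
  by (rule order_aut_model, rule auts_counted_I0)
    (rule order_aut_model, rule auts_counted_I1 auts_counted_I2 auts_counted_I3)+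

section \<open>The classification\<close>

text \<open>
  The models live on a datatype; renaming the vertices moves them to the natural numbers.
\<close>

definition relabel :: "('a \<Rightarrow> 'b) \<Rightarrow> 'a pair_pre_digraph \<Rightarrow> 'b pair_pre_digraph" where
  "relabel e K = \<lparr>pverts = e ` pverts K, parcs = map_prod e e ` parcs K\<rparr>"

context
  fixes e :: "'a \<Rightarrow> 'b" and K :: "'a pair_pre_digraph"
  assumes e: "inj e" and K: "pair_graph K"
begin

interpretation K: pair_graph K by (rule K)

lemma arcs_relabel: "(e u, e v) \<in> parcs (relabel e K) \<longleftrightarrow> (u, v) \<in> parcs K"
  using injD[OF e] by (auto simp: relabel_def)

lemma arcs_relabelE:
  assumes "(a, b) \<in> parcs (relabel e K)"
  obtains u v where "a = e u" "b = e v" "(u, v) \<in> parcs K"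
  using assms by (auto simp: relabel_def)

lemma pair_graph_relabel: "pair_graph (relabel e K)"
proof
  show "fst p \<in> pverts (relabel e K)" "snd p \<in> pverts (relabel e K)" if "p \<in> parcs (relabel e K)" for p
    using that K.in_arcsD1 K.in_arcsD2 by (auto simp: relabel_def)
  show "finite (pverts (relabel e K))" "finite (parcs (relabel e K))"
    using K.pair_finite_verts K.pair_finite_arcs by (simp_all add: relabel_def)
  show "fst p \<noteq> snd p" if "p \<in> parcs (relabel e K)" for p
    using that K.irrefl_arc by (auto simp: relabel_def inj_eq[OF e])
  have "(b, a) \<in> parcs (relabel e K)" if "(a, b) \<in> parcs (relabel e K)" for a b
    using that by (elim arcs_relabelE) (simp add: arcs_relabel K.sym_arc)
  then show "symmetric (with_proj (relabel e K))" by (simp add: symmetric_def sym_def)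
qed

lemma digraph_iso_relabel: "digraph_iso (with_proj K) (with_proj (relabel e K))"
proof -
  interpret L: pair_graph "relabel e K" by (rule pair_graph_relabel)
  have "bij_betw e (pverts K) (pverts (relabel e K))"
    using inj_on_subset[OF e] by (simp add: bij_betw_def relabel_def)
  then show ?thesis
    using arcs_relabel digraph_iso_pair_iff[OF K.pair_wf_digraph L.pair_wf_digraph] by blast
qed

lemma regular_relabel:
  assumes "regular_graph k K"
  shows "regular_graph k (relabel e K)"
  unfolding regular_graph_iff
proof (intro conjI ballI pair_graph_relabel)
  fix a assume "a \<in> pverts (relabel e K)"
  then obtain v where v: "a = e v" "v \<in> pverts K" by (auto simp: relabel_def)
  have "nbhd (relabel e K) (e v) = e ` nbhd K v"
  proof
    show "nbhd (relabel e K) (e v) \<subseteq> e ` nbhd K v"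
      using injD[OF e] by (auto simp: nbhd_def elim!: arcs_relabelE)
    show "e ` nbhd K v \<subseteq> nbhd (relabel e K) (e v)" by (auto simp: nbhd_def arcs_relabel)
  qed
  then show "card (nbhd (relabel e K) a) = k"
    using assms v card_image[OF inj_on_subset[OF e subset_UNIV]] by (simp add: regular_graph_iff)
qed

lemma no_short_cycle_relabel:
  assumes "no_short_cycle K"
  shows "no_short_cycle (relabel e K)"
proof -
  have "(c, a) \<notin> parcs (relabel e K)" if ab: "(a, b) \<in> parcs (relabel e K)" "(b, c) \<in> parcs (relabel e K)" for a b c
  proof -
    obtain u v where 1: "a = e u" "b = e v" "(u, v) \<in> parcs K" using ab(1) by (rule arcs_relabelE)
    obtain w where 2: "c = e w" "(v, w) \<in> parcs K"
      using ab(2) 1(2) injD[OF e] by (metis arcs_relabelE)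
    show ?thesis using no_triangle[OF assms 1(3) 2(2)] by (simp add: 1 2 arcs_relabel)
  qed
  moreover have "a = b \<or> c = d"
    if abcd: "(a, c) \<in> parcs (relabel e K)" "(a, d) \<in> parcs (relabel e K)"
      "(b, c) \<in> parcs (relabel e K)" "(b, d) \<in> parcs (relabel e K)" for a b c d
  proof -
    obtain u w where 1: "a = e u" "c = e w" using abcd(1) by (rule arcs_relabelE)
    obtain v z where 2: "b = e v" "d = e z" using abcd(4) by (rule arcs_relabelE)
    show ?thesis using abcd no_square[OF assms, of u w z v] by (auto simp: 1 2 arcs_relabel)
  qed
  ultimately show ?thesis unfolding no_short_cycle_def by blast
qed

lemma far_relabel:
  assumes "far K x y"
  shows "far (relabel e K) (e x) (e y)"
proof -
  have 1: "(x, y) \<notin> parcs K" "x \<noteq> y" "x \<in> pverts K" "y \<in> pverts K"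
    using assms unfolding far_def by blast+
  have 2: "(u, y) \<notin> parcs K" if "(x, u) \<in> parcs K" for u
    using assms that unfolding far_def by blast
  have 3: "(v, y) \<notin> parcs K" if "(x, u) \<in> parcs K" "(u, v) \<in> parcs K" for u v
    using assms that unfolding far_def by blast
  have 4: "\<exists>v. b = e v \<and> (u, v) \<in> parcs K" if "(e u, b) \<in> parcs (relabel e K)" for u b
    using that injD[OF e] by (metis arcs_relabelE)
  show ?thesis
    unfolding far_def
  proof (intro conjI allI impI)
    show "e x \<in> pverts (relabel e K)" "e y \<in> pverts (relabel e K)" using 1 by (auto simp: relabel_def)
    show "e x \<noteq> e y" using 1 injD[OF e] by blast
    show "(e x, e y) \<notin> parcs (relabel e K)" using 1 by (simp add: arcs_relabel)
    show "(a, e y) \<notin> parcs (relabel e K)" if "(e x, a) \<in> parcs (relabel e K)" for a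
      using 4[OF that] 2 by (auto simp: arcs_relabel)
    show "(b, e y) \<notin> parcs (relabel e K)"
      if ab: "(e x, a) \<in> parcs (relabel e K) \<and> (a, b) \<in> parcs (relabel e K)" for a b
    proof -
      obtain u where u: "a = e u" "(x, u) \<in> parcs K" using 4 ab by blast
      then obtain v where "b = e v" "(u, v) \<in> parcs K" using 4 ab by blast
      then show ?thesis using 3 u by (simp add: arcs_relabel)
    qed
  qed
qed

end

instance ix :: countable by countable_datatype
instance vert :: countable by countable_datatype

definition drawn :: "ix \<Rightarrow> nat pair_pre_digraph" where
  "drawn g = relabel to_nat (model g)"

lemma drawn_props:
  shows regular_drawn: "regular_graph 4 (drawn g)"
    and girth_drawn: "girth (drawn g) = 5"
    and diameter_drawn: "diameter (drawn g) = 4"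
    and card_drawn: "card (pverts (drawn g)) = 22"
    and order_drawn: "order (aut_group (drawn g)) = order (aut_group (model g))"
proof -
  have e: "inj (to_nat :: vert \<Rightarrow> nat)" by simp
  note K = pair_graph_model[of g]
  interpret D: pair_graph "drawn g" unfolding drawn_def by (rule pair_graph_relabel[OF e K])
  show reg: "regular_graph 4 (drawn g)"
    unfolding drawn_def by (rule regular_relabel[OF e K regular_model])
  have nsc: "no_short_cycle (drawn g)"
    unfolding drawn_def by (rule no_short_cycle_relabel[OF e K no_short_cycle_model])
  show card: "card (pverts (drawn g)) = 22"
    using card_image[OF inj_on_subset[OF e, of "set model_verts"]] card_model_verts
    by (simp add: drawn_def relabel_def pverts_model)
  obtain a b c d f where cyc: "(a, b) \<in> parcs (model g)" "(b, c) \<in> parcs (model g)" "(c, d) \<in> parcs (model g)"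
    "(d, f) \<in> parcs (model g)" "(f, a) \<in> parcs (model g)" "distinct [a, b, c, d, f]"
    by (rule five_cycle_model)
  show "girth (drawn g) = 5"
    using cyc(6) cyc(1-5)[folded arcs_relabel[OF e K], folded drawn_def]
    by (intro D.girth_eq_5I[OF nsc, of "to_nat a" "to_nat b" "to_nat c" "to_nat d" "to_nat f"]) auto
  show "diameter (drawn g) = 4"
  proof (rule D.diameter_eq_4I[OF _ nsc])
    show "card (nbhd (drawn g) v) = 4" if "v \<in> pverts (drawn g)" for v
      using reg that by (simp add: regular_graph_iff)
    show "far (drawn g) (to_nat X) (to_nat Y)"
      unfolding drawn_def by (rule far_relabel[OF e K far_model])
  qed (simp add: card)
  show "order (aut_group (drawn g)) = order (aut_group (model g))"
    using digraph_iso_order_aut_group[OF K D.pair_graph] digraph_iso_relabel[OF e K]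
    by (simp add: drawn_def)
qed

lemma classification:
  assumes reg: "regular_graph 4 H" and "girth H = 5" "diameter H = 4" "card (pverts H) = 22"
  shows "\<exists>g. digraph_iso (with_proj (drawn g)) (with_proj H)"
proof -
  interpret H: pair_graph H using reg by (simp add: regular_graph_iff)
  have deg: "card (nbhd H v) = 4" if "v \<in> pverts H" for v
    using reg that by (simp add: regular_graph_iff)
  have nsc: "no_short_cycle H" using assms(2) by (rule H.girth_5_imp_no_short_cycle)
  obtain x y where far: "far H x y" using assms(3) by (rule H.diameter_4_obtains_far)
  obtain f where f: "framed H f" by (rule H.obtain_frame[OF deg nsc assms(4) far])
  have "\<exists>g h. bij_betw h (set model_verts) (pverts H) \<and>
      (\<forall>u \<in> set model_verts. \<forall>v \<in> set model_verts. v \<in> set (nbrs_via (ring_nbrs g) u) \<longrightarrow> (h u, h v) \<in> parcs H)"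
    by (rule H.exists_labelling[OF deg nsc f])
  then obtain g h where h: "bij_betw h (set model_verts) (pverts H)"
    and hom: "\<forall>u \<in> set model_verts. \<forall>v \<in> set model_verts. v \<in> set (nbrs_via (ring_nbrs g) u) \<longrightarrow> (h u, h v) \<in> parcs H"
    by (elim exE conjE)
  interpret D: pair_graph "drawn g" using regular_drawn[of g] by (simp add: regular_graph_iff)
  let ?f = "\<lambda>n. h (from_nat n)"
  have "bij_betw from_nat (pverts (drawn g)) (set model_verts)"
    by (rule bij_betw_byWitness[of _ to_nat]) (auto simp: drawn_def relabel_def pverts_model)
  then have bij: "bij_betw ?f (pverts (drawn g)) (pverts H)"
    using bij_betw_trans[OF _ h] by (simp add: comp_def)
  have "(?f a, ?f b) \<in> parcs H" if ab: "(a, b) \<in> parcs (drawn g)" for a b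
  proof -
    obtain u v where uv: "a = to_nat u" "b = to_nat v" "u \<in> set model_verts" "v \<in> set (model_nbrs g u)"
      using ab by (auto simp: drawn_def relabel_def model_arcs)
    then show ?thesis using hom model_nbrs_facts(2)[OF uv(3,4)] by (simp add: model_nbrs_def)
  qed
  then have "(?f a, ?f b) \<in> parcs H \<longleftrightarrow> (a, b) \<in> parcs (drawn g)"
    if "a \<in> pverts (drawn g)" "b \<in> pverts (drawn g)" for a b
    by (rule regular_hom_iff[OF regular_drawn reg bij _ that])
  then have "digraph_iso (with_proj (drawn g)) (with_proj H)"
    unfolding digraph_iso_pair_iff[OF D.pair_wf_digraph H.pair_wf_digraph]
    using bij by (intro exI[of _ ?f]) simp
  then show ?thesis ..
qed

theorem mainTheorem3:
  shows "\<exists>G :: nat \<Rightarrow> nat pair_pre_digraph.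
    (\<forall>i < 4. regular_graph 4 (G i) \<and> girth (G i) = 5 \<and> diameter (G i) = 4 \<and>
       card (pverts (G i)) = 4\<^sup>2 + 4 + 2) \<and>
    (\<forall>i < 4. \<forall>j < 4. i \<noteq> j \<longrightarrow> \<not> digraph_iso (with_proj (G i)) (with_proj (G j))) \<and>
    (\<forall>H :: 'a pair_pre_digraph.
       regular_graph 4 H \<and> girth H = 5 \<and> diameter H = 4 \<and> card (pverts H) = 4\<^sup>2 + 4 + 2 \<longrightarrow>
       (\<exists>i < 4. digraph_iso (with_proj (G i)) (with_proj H))) \<and>
    order (aut_group (G 0)) = 1 \<and> order (aut_group (G 1)) = 2 \<and>
    order (aut_group (G 2)) = 4 \<and> order (aut_group (G 3)) = 8"
proof -
  define G where "G i = drawn (ixs ! i)" for i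
  have ord: "order (aut_group (G 0)) = 1" "order (aut_group (G 1)) = 2"
    "order (aut_group (G 2)) = 4" "order (aut_group (G 3)) = 8"
    by (simp_all add: G_def ixs_def order_drawn order_aut_group_model)
  have pg: "pair_graph (G i)" for i
    using regular_drawn by (simp add: G_def regular_graph_iff)
  have "\<not> digraph_iso (with_proj (G i)) (with_proj (G j))" if "i < 4" "j < 4" "i \<noteq> j" for i j
  proof
    assume "digraph_iso (with_proj (G i)) (with_proj (G j))"
    then have "order (aut_group (G i)) = order (aut_group (G j))"
      by (rule digraph_iso_order_aut_group[OF pg pg])
    moreover have "i \<in> {0, 1, 2, 3}" "j \<in> {0, 1, 2, 3}" using that by auto
    ultimately show False using \<open>i \<noteq> j\<close> ord by (elim insertE emptyE) simp_all
  qed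
  moreover have "\<exists>i < 4. digraph_iso (with_proj (G i)) (with_proj H)"
    if H: "regular_graph 4 H" "girth H = 5" "diameter H = 4" "card (pverts H) = 4\<^sup>2 + 4 + 2"
    for H :: "'a pair_pre_digraph"
  proof -
    obtain g where g: "digraph_iso (with_proj (drawn g)) (with_proj H)"
      using classification[OF H(1-3)] H(4) by auto
    have "g \<in> set ixs" by (simp add: set_ixs)
    then obtain i where "i < length ixs" "ixs ! i = g" unfolding in_set_conv_nth by blast
    moreover have "length ixs = 4" by (simp add: ixs_def)
    ultimately show ?thesis using g by (auto simp: G_def)
  qed
  ultimately show ?thesis
    using ord by (intro exI[of _ G]) (simp add: G_def regular_drawn girth_drawn diameter_drawn card_drawn)
qed

end
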